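(* Let $X$ and $Y$ be Banach spaces. Then $$\mathcal{FR}(X,Y)\subseteq\overline{\{R\in\mathcal{FR}(X,Y)\colon R^*\in\operatorname{RSE}(Y^*,X^* )\}}.$$ If, moreover, $X^*$ or $Y$ has the approximation property, then $$\mathcal{K}(X,Y)\subseteq\overline{\{R\in\mathcal{FR}(X,Y)\colon R^*\in\operatorname{RSE}(Y^*,X^* )\}}.$$
   Context: Banach spaces are over $\mathbb{K}$, where $\mathbb{K}=\mathbb{R}$ or $\mathbb{C}$, and are nonzero. $\mathbb{T}=\{\theta\in\mathbb{K}\colon|\theta|=1\}$; $B_X$, $S_X$ are the closed unit ball and unit sphere; $\mathcal{L}(X,Y)$ is the space of bounded linear operators with the operator norm, closures are in this norm; $\mathcal{FR}(X,Y)$ and $\mathcal{K}(X,Y)$ are the sets of finite-rank and compact operators; $R^*\in\mathcal{L}(Y^*,X^* )$ is the adjoint of $R$. $T\in\operatorname{RSE}(X,Y)$ (range strongly exposing) means: there exists $x_0\in S_X$ such that whenever $(x_n)\subseteq B_X$ satisfies $\|Tx_n\|\to\|T\|$, there are a subsequence $(x_{\sigma(n)})$ and $\theta\in\mathbb{T}$ with $Tx_{\sigma(n)}\to\theta Tx_0$ in norm; the same definition is used for $\operatorname{RSE}(Y^*,X^* )$. *)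

theory Defs
  imports "HOL-Analysis.Analysis"
begin

text \<open>The scalar field is an isometric copy of the reals or of the complex numbers, so that
  both cases are treated by one statement; both types are instances below.\<close>

class real_or_complex = real_normed_field +
  assumes real_or_complex: "\<exists>h :: 'a \<Rightarrow> complex.
    (\<forall>a b. h (a + b) = h a + h b) \<and> (\<forall>a b. h (a * b) = h a * h b) \<and>
    (\<forall>r a. h (r *\<^sub>R a) = r *\<^sub>R h a) \<and> (\<forall>a. norm (h a) = norm a) \<and>
    (range h = \<real> \<or> range h = UNIV)"

instance real :: real_or_complex
proof
  have "range complex_of_real = \<real>"
    by (simp add: Reals_def)
  then show "\<exists>h :: real \<Rightarrow> complex.
    (\<forall>a b. h (a + b) = h a + h b) \<and> (\<forall>a b. h (a * b) = h a * h b) \<and>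
    (\<forall>r a. h (r *\<^sub>R a) = r *\<^sub>R h a) \<and> (\<forall>a. norm (h a) = norm a) \<and>
    (range h = \<real> \<or> range h = UNIV)"
    by (intro exI[of _ complex_of_real]) (simp add: scaleR_conv_of_real)
qed

instance complex :: real_or_complex
proof
  show "\<exists>h :: complex \<Rightarrow> complex.
    (\<forall>a b. h (a + b) = h a + h b) \<and> (\<forall>a b. h (a * b) = h a * h b) \<and>
    (\<forall>r a. h (r *\<^sub>R a) = r *\<^sub>R h a) \<and> (\<forall>a. norm (h a) = norm a) \<and>
    (range h = \<real> \<or> range h = UNIV)"
    by (intro exI[of _ "\<lambda>z. z"]) simp
qed

text \<open>A normed space over such a field is a real normed space with a scalar multiplication that
  extends the real one and for which the norm is homogeneous.\<close>

locale normed_space_over = vector_space scale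
  for scale :: "'k::real_or_complex \<Rightarrow> 'a::real_normed_vector \<Rightarrow> 'a" +
  assumes scale_of_real: "scale (of_real r) x = r *\<^sub>R x"
    and norm_scale: "norm (scale c x) = norm c * norm x"

text \<open>The type of bounded real-linear maps serves as ambient space: the operators over the
  scalar field form a closed subspace of it, and its norm is the operator norm. Hence closures
  of sets of operators may be taken in that type.\<close>

definition bounded_ops ::
  "('k \<Rightarrow> 'a \<Rightarrow> 'a) \<Rightarrow> ('k \<Rightarrow> 'b \<Rightarrow> 'b) \<Rightarrow> ('a::real_normed_vector \<Rightarrow>\<^sub>L 'b::real_normed_vector) set"
  where "bounded_ops sX sY = {T. \<forall>c x. blinfun_apply T (sX c x) = sY c (blinfun_apply T x)}"

definition finite_rank_ops ::
  "('k::real_or_complex \<Rightarrow> 'a \<Rightarrow> 'a) \<Rightarrow> ('k \<Rightarrow> 'b \<Rightarrow> 'b)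
    \<Rightarrow> ('a::real_normed_vector \<Rightarrow>\<^sub>L 'b::real_normed_vector) set"
  where "finite_rank_ops sX sY =
    {T \<in> bounded_ops sX sY. \<exists>B. finite B \<and> range (blinfun_apply T) \<subseteq> module.span sY B}"

definition compact_ops ::
  "('k \<Rightarrow> 'a \<Rightarrow> 'a) \<Rightarrow> ('k \<Rightarrow> 'b \<Rightarrow> 'b) \<Rightarrow> ('a::real_normed_vector \<Rightarrow>\<^sub>L 'b::real_normed_vector) set"
  where "compact_ops sX sY =
    {T \<in> bounded_ops sX sY. compact (closure (blinfun_apply T ` cball 0 1))}"

text \<open>The dual space is a subspace of the type of bounded real-linear maps into the field; this is
  why the notions applied to duals below carry an explicit carrier set.\<close>

definition dual :: "('k \<Rightarrow> 'a \<Rightarrow> 'a) \<Rightarrow> ('a::real_normed_vector \<Rightarrow>\<^sub>L 'k::real_or_complex) set"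
  where "dual sX = bounded_ops sX (*)"

definition dual_scale ::
  "'k \<Rightarrow> ('a::real_normed_vector \<Rightarrow>\<^sub>L 'k::real_or_complex) \<Rightarrow> ('a \<Rightarrow>\<^sub>L 'k)"
  where "dual_scale c f = blinfun_mult_right c o\<^sub>L f"

definition adjoint_op ::
  "('a::real_normed_vector \<Rightarrow>\<^sub>L 'b::real_normed_vector) \<Rightarrow> ('b \<Rightarrow>\<^sub>L 'k::real_or_complex) \<Rightarrow> ('a \<Rightarrow>\<^sub>L 'k)"
  where "adjoint_op R f = f o\<^sub>L R"

text \<open>The operator norm of the restriction of \<open>T\<close> to the subspace \<open>V\<close>, meaningful when that
  restriction is bounded.\<close>

definition op_norm_on :: "'a::real_normed_vector set \<Rightarrow> ('a \<Rightarrow> 'b::real_normed_vector) \<Rightarrow> real"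
  where "op_norm_on V T = (SUP x\<in>V \<inter> cball 0 1. norm (T x))"

definition range_strongly_exposing ::
  "('k::real_or_complex \<Rightarrow> 'b \<Rightarrow> 'b) \<Rightarrow> 'a::real_normed_vector set
    \<Rightarrow> ('a \<Rightarrow> 'b::real_normed_vector) \<Rightarrow> bool"
  where "range_strongly_exposing sW V T \<longleftrightarrow>
    (\<exists>x0\<in>V. norm x0 = 1 \<and>
      (\<forall>x. (\<forall>n. x n \<in> V \<inter> cball 0 1) \<and> (\<lambda>n. norm (T (x n))) \<longlonglongrightarrow> op_norm_on V T \<longrightarrow>
        (\<exists>\<sigma> \<theta>. strict_mono (\<sigma> :: nat \<Rightarrow> nat) \<and> norm \<theta> = 1 \<and>
          (\<lambda>n. T (x (\<sigma> n))) \<longlonglongrightarrow> sW \<theta> (T x0))))"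

text \<open>The approximation property of the subspace \<open>V\<close>: the identity of \<open>V\<close> is approximated,
  uniformly on compact sets, by bounded finite-rank operators from \<open>V\<close> to \<open>V\<close>. Only the values of
  such an operator on \<open>V\<close> matter.\<close>

definition finite_rank_on ::
  "('k::real_or_complex \<Rightarrow> 'a \<Rightarrow> 'a) \<Rightarrow> 'a::real_normed_vector set \<Rightarrow> ('a \<Rightarrow> 'a) \<Rightarrow> bool"
  where "finite_rank_on s V T \<longleftrightarrow>
    (\<forall>x\<in>V. \<forall>y\<in>V. T (x + y) = T x + T y) \<and>
    (\<forall>c. \<forall>x\<in>V. T (s c x) = s c (T x)) \<and>
    (\<exists>M. \<forall>x\<in>V. norm (T x) \<le> M * norm x) \<and>
    T ` V \<subseteq> V \<and>
    (\<exists>B. finite B \<and> T ` V \<subseteq> module.span s B)"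

definition approximation_property ::
  "('k::real_or_complex \<Rightarrow> 'a \<Rightarrow> 'a) \<Rightarrow> 'a::real_normed_vector set \<Rightarrow> bool"
  where "approximation_property s V \<longleftrightarrow>
    (\<forall>C e. compact C \<and> C \<subseteq> V \<and> e > 0 \<longrightarrow>
      (\<exists>T. finite_rank_on s V T \<and> (\<forall>x\<in>C. norm (T x - x) < e)))"

lemma normed_space_over_real: "normed_space_over ((*\<^sub>R) :: real \<Rightarrow> 'a::real_normed_vector \<Rightarrow> 'a)"
  by standard (auto simp: algebra_simps)

lemma dual_scale_apply: "blinfun_apply (dual_scale c f) x = c * blinfun_apply f x"
  by (simp add: dual_scale_def)

lemma normed_space_over_dual:
  "normed_space_over (dual_scale :: 'k::real_or_complex \<Rightarrow> ('a::real_normed_vector \<Rightarrow>\<^sub>L 'k) \<Rightarrow> _)"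
proof
  fix c :: 'k and f :: "'a \<Rightarrow>\<^sub>L 'k"
  have le: "norm (dual_scale d g) \<le> norm d * norm g" for d :: 'k and g :: "'a \<Rightarrow>\<^sub>L 'k"
    by (rule norm_blinfun_bound)
      (auto simp: dual_scale_apply norm_mult mult.assoc intro!: mult_left_mono norm_blinfun)
  show "norm (dual_scale c f) = norm c * norm f"
  proof (cases "c = 0")
    case True
    then show ?thesis using le[of c f] by simp
  next
    case False
    have "f = dual_scale (inverse c) (dual_scale c f)"
      using False by (intro blinfun_eqI) (simp add: dual_scale_apply)
    then have "norm f \<le> inverse (norm c) * norm (dual_scale c f)"
      using le[of "inverse c" "dual_scale c f"] by (simp add: norm_inverse)
    with le[of c f] False show ?thesis by (simp add: field_simps)
  qed
qed (auto intro!: blinfun_eqI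
      simp: dual_scale_apply blinfun.add_left blinfun.scaleR_left algebra_simps scaleR_conv_of_real)

lemma dual_scale_in_dual: "f \<in> dual sX \<Longrightarrow> dual_scale c f \<in> dual sX"
  by (auto simp: dual_def bounded_ops_def dual_scale_apply algebra_simps)

lemma adjoint_op_in_dual: "R \<in> bounded_ops sX sY \<Longrightarrow> f \<in> dual sY \<Longrightarrow> adjoint_op R f \<in> dual sX"
  by (auto simp: dual_def bounded_ops_def adjoint_op_def)

lemma (in normed_space_over) closed_bounded_ops:
  "closed (bounded_ops (sX :: _ \<Rightarrow> 'c::real_normed_vector \<Rightarrow> _) scale)"
proof -
  have bl: "bounded_linear (scale c)" for c
  proof
    show "\<exists>K. \<forall>x. norm (scale c x) \<le> norm x * K"
      by (intro exI[of _ "norm c"]) (simp add: norm_scale mult.commute)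
    show "scale c (r *\<^sub>R x) = r *\<^sub>R scale c x" for r x
      unfolding scale_of_real[symmetric] scale_scale by (simp only: mult.commute)
  qed (rule scale_right_distrib)
  have apply_cont: "continuous_on UNIV (\<lambda>T :: 'c \<Rightarrow>\<^sub>L 'a. blinfun_apply T x)" for x
    by (intro continuous_intros)
  have "continuous_on UNIV (\<lambda>T :: 'c \<Rightarrow>\<^sub>L 'a. scale c (blinfun_apply T x))" for c x
    by (rule bounded_linear.continuous_on[OF bl apply_cont])
  then show ?thesis
    unfolding bounded_ops_def
    by (intro closed_Collect_all closed_Collect_eq apply_cont)
qed

end

theory Submission
  imports Defs
begin

text \<open>Write a finite-rank operator as \<open>R u = (\<Sum>i<n. c\<^sub>i(u) e\<^sub>i)\<close> with \<open>c\<^sub>i\<close> in the dual of \<open>X\<close> and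
\<open>e\<^sub>i\<close> in \<open>Y\<close>. Then \<open>R\<^sup>* y\<close> depends only on the coordinates \<open>y(e\<^sub>i)\<close>, so the function
\<open>\<Phi>(y) = norm (R\<^sup>* y) + \<delta> (\<Sum>i<n. |y(e\<^sub>i)|\<^sup>2)\<close> is continuous for pointwise convergence and, the dual
ball being compact in that topology, has a maximiser \<open>y0\<close>. Expanding the square around \<open>y0\<close>
(\<open>|b|\<^sup>2 = |a|\<^sup>2 + 2 Re (cj a (b - a)) + |b - a|\<^sup>2\<close>) turns this into

  \<open>norm (R\<^sup>* y) + 2 \<delta> Re y(w) + \<delta> (\<Sum>i<n. |y(e\<^sub>i) - y0(e\<^sub>i)|\<^sup>2) \<le> norm (R\<^sup>* y0) + 2 \<delta> y0(w)\<close>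

with \<open>w = (\<Sum>i<n. cj (y0(e\<^sub>i)) e\<^sub>i)\<close>: strict convexity of the square makes evaluation at \<open>w\<close>
a perturbation of the norm that exposes the coordinates of \<open>y0\<close> on the dual ball. Let \<open>v\<close> be the
unit functional in the direction of \<open>R\<^sup>* y0\<close> (any unit functional if that is zero) and add the small rank-one operator \<open>2 \<delta> v(\<cdot>) w\<close> to \<open>R\<close>. The adjoint of the sum maps \<open>y\<close> to
\<open>R\<^sup>* y + 2 \<delta> y(w) v\<close>, whose norm is at most \<open>norm (R\<^sup>* y) + 2 \<delta> |y(w)|\<close>, with equality at \<open>y0\<close>.
After rotating \<open>y\<close> so that \<open>y(w) \<ge> 0\<close>, the displayed inequality says that a norming sequence has
coordinates converging, up to rotations, to those of \<open>y0\<close>; since the rotations subconverge, the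
perturbed adjoint is range strongly exposing (\<open>ex_range_strongly_exposing_near\<close>).

For compact operators \<open>T\<close> it remains to approximate \<open>T\<close> by finite-rank operators. If \<open>Y\<close> has the
approximation property, compose \<open>T\<close> with a finite-rank operator close to the identity on
\<open>closure (T(ball))\<close>. If the dual of \<open>X\<close> has it, take a finite-rank operator
\<open>S z = (\<Sum>i<n. \<phi>\<^sub>i(z) b\<^sub>i)\<close> on the dual close to the identity on \<open>L = T\<^sup>*(ball)\<close>, which is compact. The
\<open>\<phi>\<^sub>i\<close> belong to the bidual of \<open>X\<close>, but on the compact set \<open>L\<close> they are uniformly close to
evaluations at points \<open>x\<^sub>i\<close> of \<open>X\<close> (\<open>ex_evaluation_near_compact\<close>, a form of Helly's theorem), so
\<open>R u = (\<Sum>i<n. b\<^sub>i(u) T x\<^sub>i)\<close> has an adjoint close to \<open>S \<circ> T\<^sup>*\<close>, hence is close to \<open>T\<close>.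

The two tools from functional analysis are the Hahn-Banach theorem, obtained from minimal sublinear
functionals, and the compactness of the dual ball in the topology of pointwise convergence.\<close>

section \<open>Scalars\<close>

text \<open>The class only asserts that an isometric embedding into the complex numbers exists. Fixing one
gives real parts and conjugates that specialise to the usual ones in both cases.\<close>
definition emb :: "'k::real_or_complex \<Rightarrow> complex" where
  "emb = (SOME h. (\<forall>a b. h (a + b) = h a + h b) \<and> (\<forall>a b. h (a * b) = h a * h b) \<and>
    (\<forall>r a. h (r *\<^sub>R a) = r *\<^sub>R h a) \<and> (\<forall>a. norm (h a) = norm a) \<and>
    (range h = \<real> \<or> range h = UNIV))"

lemma
  shows emb_add: "emb (a + b) = emb a + emb (b :: 'k::real_or_complex)"
    and emb_mult: "emb (a * b) = emb a * emb b"
    and emb_scaleR: "emb (r *\<^sub>R a) = r *\<^sub>R emb a"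
    and norm_emb: "norm (emb a) = norm a"
    and range_emb: "range (emb :: 'k \<Rightarrow> complex) = \<real> \<or> range (emb :: 'k \<Rightarrow> complex) = UNIV"
  using someI_ex[OF real_or_complex[where 'a='k], folded emb_def] by blast+

lemma bounded_linear_emb: "bounded_linear emb"
  by (rule bounded_linear_intro[of _ 1]) (auto simp: emb_add emb_scaleR norm_emb)

lemma emb_diff: "emb (a - b) = emb a - emb b"
  by (rule bounded_linear.axioms(1)[OF bounded_linear_emb, THEN linear_diff])

lemma emb_eq_iff: "emb a = emb b \<longleftrightarrow> a = b"
  using norm_emb[of "a - b"] by (metis emb_diff norm_eq_zero right_minus_eq)

lemma emb_one: "emb 1 = 1"
proof -
  have "emb (1 :: 'a) * emb (1 :: 'a) = emb (1 :: 'a)" using emb_mult[of 1 "1 :: 'a"] by simp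
  moreover have "emb (1 :: 'a) \<noteq> 0" using norm_emb[of "1 :: 'a"] by auto
  ultimately show ?thesis by simp
qed

lemma emb_of_real: "emb (of_real r) = of_real r"
  by (simp add: of_real_def emb_scaleR emb_one)

definition re :: "'k::real_or_complex \<Rightarrow> real" where "re a = Re (emb a)"

definition cj :: "'k::real_or_complex \<Rightarrow> 'k" where "cj a = inv emb (cnj (emb a))"

lemma emb_cj: "emb (cj a) = cnj (emb a)"
proof -
  have "cnj (emb a) \<in> range (emb :: 'a \<Rightarrow> complex)"
    using range_emb[where 'k='a] Reals_cnj_iff[of "emb a"] rangeI[of emb a] by (metis UNIV_I)
  then show ?thesis unfolding cj_def by (rule f_inv_into_f)
qed

lemma bounded_linear_re: "bounded_linear re"
  unfolding re_def by (rule bounded_linear_compose[OF bounded_linear_Re bounded_linear_emb])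

lemmas re_simps = linear_add[OF bounded_linear.axioms(1)[OF bounded_linear_re]]
  linear_diff[OF bounded_linear.axioms(1)[OF bounded_linear_re]]
  linear_sum[OF bounded_linear.axioms(1)[OF bounded_linear_re]]
  linear_scale[OF bounded_linear.axioms(1)[OF bounded_linear_re]]

lemma re_of_real: "re (of_real r) = r"
  by (simp add: re_def emb_of_real)

lemma re_le_norm: "re a \<le> norm a"
  using complex_Re_le_cmod[of "emb a"] by (simp add: re_def norm_emb)

lemma norm_cj: "norm (cj a) = norm a"
  by (metis complex_mod_cnj emb_cj norm_emb)

lemma cj_mult_self: "cj (a :: 'k::real_or_complex) * a = of_real ((norm a)\<^sup>2)"
proof -
  have "emb (cj a * a) = emb (of_real ((norm a)\<^sup>2) :: 'k)"
    using complex_norm_square[of "emb a"]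
    by (simp add: emb_mult emb_cj emb_of_real norm_emb mult.commute del: of_real_power)
  then show ?thesis by (simp only: emb_eq_iff)
qed

text \<open>The term quadratic in \<open>b - a\<close> is the gap that later forces maximising sequences to converge.\<close>
lemma norm_square_expand:
  "(norm (b :: 'k::real_or_complex))\<^sup>2 = (norm a)\<^sup>2 + 2 * re (cj a * (b - a)) + (norm (b - a))\<^sup>2"
proof -
  have "(norm z)\<^sup>2 = (Re (emb z))\<^sup>2 + (Im (emb z))\<^sup>2" for z :: 'k
    by (metis cmod_power2 norm_emb)
  then show ?thesis
    by (simp add: re_def emb_mult emb_cj emb_diff) (simp add: power2_eq_square algebra_simps)
qed

lemma eq_of_real_if_re_max:
  assumes "norm a \<le> r" "re a = r" shows "a = of_real r"
proof -
  have "Im (emb a) = 0" "Re (emb a) = r"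
    using assms cmod_power2[of "emb a"] power_mono[OF assms(1), of 2]
    by (auto simp: norm_emb re_def)
  then show ?thesis
    by (metis complex_eq_iff complex_of_real_def complex.sel emb_eq_iff emb_of_real)
qed

lemma ex_rotation: "\<exists>\<theta> :: 'k::real_or_complex. norm \<theta> = 1 \<and> \<theta> * a = of_real (norm a)"
proof (cases "a = 0")
  case False
  then show ?thesis
    by (intro exI[of _ "of_real (norm a) / a"]) (simp add: norm_divide)
qed (auto intro: exI[of _ 1])

text \<open>Compactness is transported along the isometry \<open>emb\<close>, whose range is closed.\<close>
lemma compact_cball_scalar: "compact (cball (0 :: 'k::real_or_complex) r)"
proof -
  let ?e = "emb :: 'k \<Rightarrow> complex"
  have "closed (range ?e)" using range_emb[where 'k='k] closed_complex_Reals by auto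
  then have "compact (range ?e \<inter> cball 0 r)" by (intro closed_Int_compact) auto
  moreover have "continuous_on (range ?e \<inter> cball 0 r) (inv ?e)"
  proof (rule continuous_on_subset)
    have "dist (inv ?e x) (inv ?e y) = dist x y" if "x \<in> range ?e" "y \<in> range ?e" for x y
      using f_inv_into_f[OF that(1)] f_inv_into_f[OF that(2)] norm_emb[of "inv ?e x - inv ?e y"]
      by (simp add: dist_norm emb_diff)
    then show "continuous_on (range ?e) (inv ?e)"
      unfolding continuous_on_iff by auto
  qed auto
  ultimately have "compact (inv ?e ` (range ?e \<inter> cball 0 r))"
    by (rule compact_continuous_image[rotated])
  also have "inv ?e ` (range ?e \<inter> cball 0 r) = cball 0 r"
  proof -
    have inv: "inv ?e (?e a) = a" for a by (simp add: inv_f_f inj_def emb_eq_iff)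
    show ?thesis
    proof
      show "inv ?e ` (range ?e \<inter> cball 0 r) \<subseteq> cball 0 r"
        using inv by (auto simp: norm_emb)
    next
      have "a = inv ?e (?e a)" "?e a \<in> range ?e \<inter> cball 0 r" if "a \<in> cball 0 r" for a
        using that inv by (simp_all add: norm_emb)
      then show "cball 0 r \<subseteq> inv ?e ` (range ?e \<inter> cball 0 r)" by blast
    qed
  qed
  finally show ?thesis .
qed

section \<open>The Hahn-Banach theorem\<close>

definition sublinear :: "('a::real_vector \<Rightarrow> real) \<Rightarrow> bool" where
  "sublinear p \<longleftrightarrow> (\<forall>x y. p (x + y) \<le> p x + p y) \<and> (\<forall>c x. c \<ge> 0 \<longrightarrow> p (c *\<^sub>R x) = c * p x)"

lemma sublinear_zero: "sublinear p \<Longrightarrow> p 0 = 0"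
proof -
  assume "sublinear p"
  then have "p (0 *\<^sub>R 0) = 0 * p 0" unfolding sublinear_def by blast
  then show ?thesis by simp
qed

lemma sublinear_ge: "sublinear p \<Longrightarrow> - p (- x) \<le> p x"
proof -
  assume p: "sublinear p"
  then have "p (x + - x) \<le> p x + p (- x)" unfolding sublinear_def by blast
  then show ?thesis using sublinear_zero[OF p] by simp
qed

text \<open>The condition on sums covers both uses: a downward directed family (a chain) and the family
\<open>x \<mapsto> p (x + t *\<^sub>R a) - t * p a\<close> for \<open>t \<ge> 0\<close>.\<close>
lemma sublinear_INF:
  fixes q :: "'i \<Rightarrow> 'a::real_vector \<Rightarrow> real"
  assumes "I \<noteq> {}" and "\<And>x. bdd_below ((\<lambda>i. q i x) ` I)"
    and add: "\<And>i j x y. i \<in> I \<Longrightarrow> j \<in> I \<Longrightarrow> \<exists>k\<in>I. q k (x + y) \<le> q i x + q j y"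
    and scale: "\<And>i c x. i \<in> I \<Longrightarrow> c > 0 \<Longrightarrow> \<exists>j\<in>I. q j (c *\<^sub>R x) \<le> c * q i x"
    and zero: "\<And>i. i \<in> I \<Longrightarrow> q i 0 = 0"
  shows "sublinear (\<lambda>x. INF i\<in>I. q i x)"
  unfolding sublinear_def
proof (intro conjI allI impI)
  let ?Q = "\<lambda>x. INF i\<in>I. q i x"
  have low: "?Q x \<le> q i x" if "i \<in> I" for i x using that assms(2) by (rule cINF_lower[rotated])
  show "?Q (x + y) \<le> ?Q x + ?Q y" for x y
  proof -
    have "?Q (x + y) \<le> q i x + q j y" if "i \<in> I" "j \<in> I" for i j
      using add[OF that] low by (meson order_trans)
    then have "?Q (x + y) - q i x \<le> q j y" if "i \<in> I" "j \<in> I" for i j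
      using that by (metis add.commute diff_le_eq)
    then have "?Q (x + y) - q i x \<le> ?Q y" if "i \<in> I" for i
      using that by (intro cINF_greatest[OF assms(1)])
    then have "?Q (x + y) - ?Q y \<le> q i x" if "i \<in> I" for i
      using that by (metis add.commute diff_le_eq)
    then have "?Q (x + y) - ?Q y \<le> ?Q x" by (intro cINF_greatest[OF assms(1)])
    then show ?thesis by simp
  qed
  have scale_le: "?Q (c *\<^sub>R x) \<le> c * ?Q x" if "c > 0" for c x
  proof -
    have "?Q (c *\<^sub>R x) / c \<le> q i x" if "i \<in> I" for i
      using scale[OF that \<open>c > 0\<close>, of x] low \<open>c > 0\<close>
      by (auto simp: divide_le_eq mult.commute intro: order_trans)
    then have "?Q (c *\<^sub>R x) / c \<le> ?Q x" using assms(1) by (intro cINF_greatest)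
    then show ?thesis using that by (simp add: divide_le_eq mult.commute)
  qed
  show "?Q (c *\<^sub>R x) = c * ?Q x" if "c \<ge> 0" for c x
  proof (cases "c = 0")
    case True
    then show ?thesis using assms(1) zero by simp
  next
    case False
    then have "c * ?Q x \<le> ?Q (c *\<^sub>R x)"
      using scale_le[of "inverse c" "c *\<^sub>R x"] that by (simp add: field_simps)
    then show ?thesis using scale_le[of c x] that False by simp
  qed
qed

text \<open>Take \<open>q x = (INF t\<in>{0..}. p (x + t *\<^sub>R a) - t * p a)\<close> and compare with
\<open>t = 0\<close> and \<open>t = 1\<close>. The last property makes a minimal sublinear functional additive. At
\<open>x = - a\<close> it shows that a linear functional below \<open>q\<close> is at least \<open>p a\<close> at \<open>a\<close>.\<close>
lemma sublinear_lower_at: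
  fixes p :: "'a::real_vector \<Rightarrow> real"
  assumes p: "sublinear p"
  obtains q where "sublinear q" "q \<le> p" "\<And>x. q x \<le> p (x + a) - p a" 
proof -
  have add: "p (x + y) \<le> p x + p y" and scale: "c \<ge> 0 \<Longrightarrow> p (c *\<^sub>R x) = c * p x" for x y c
    using p by (auto simp: sublinear_def)
  define q where "q = (\<lambda>x. INF t\<in>{0..}. p (x + t *\<^sub>R a) - t * p a)"
  have bdd: "bdd_below ((\<lambda>t. p (x + t *\<^sub>R a) - t * p a) ` {0..})" for x
  proof (rule bdd_belowI2)
    fix t :: real assume "t \<in> {0..}"
    then show "- p (- x) \<le> p (x + t *\<^sub>R a) - t * p a"
      using add[of "- x" "x + t *\<^sub>R a"] scale[of t a] by simp
  qed
  show thesis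
  proof
    show "sublinear q" unfolding q_def
    proof (rule sublinear_INF)
      fix i j :: real and x y assume "i \<in> {0..}" "j \<in> {0..}"
      then show "\<exists>k\<in>{0..}. p (x + y + k *\<^sub>R a) - k * p a
          \<le> p (x + i *\<^sub>R a) - i * p a + (p (y + j *\<^sub>R a) - j * p a)"
        using add[of "x + i *\<^sub>R a" "y + j *\<^sub>R a"]
        by (intro bexI[of _ "i + j"]) (auto simp: algebra_simps)
    next
      fix i c :: real and x assume "i \<in> {0..}" "c > 0"
      then show "\<exists>j\<in>{0..}. p (c *\<^sub>R x + j *\<^sub>R a) - j * p a \<le> c * (p (x + i *\<^sub>R a) - i * p a)"
        using scale[of c "x + i *\<^sub>R a"]
        by (intro bexI[of _ "c * i"]) (auto simp: algebra_simps)
    qed (auto simp: scale bdd)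
    show "q \<le> p" unfolding le_fun_def q_def using cINF_lower[OF bdd, of 0] by simp
    show "q x \<le> p (x + a) - p a" for x
      unfolding q_def using cINF_lower[OF bdd, of 1] by simp
  qed
qed

text \<open>By Zorn's lemma there is a minimal sublinear functional below \<open>p\<close>; minimality and
\<open>sublinear_lower_at\<close> make it linear. Working with functionals on the whole space avoids extending
partial functionals one dimension at a time.\<close>
lemma hahn_banach_sublinear:
  fixes p :: "'a::real_vector \<Rightarrow> real"
  assumes p: "sublinear p"
  obtains f where "linear f" "f \<le> p"
proof -
  let ?A = "{q. sublinear q \<and> q \<le> p}"
  have "\<exists>q\<in>?A. \<forall>r\<in>?A. r \<le> q \<longrightarrow> r = q"
  proof (rule predicate_Zorn)
    show "partial_order_on ?A (relation_of (\<lambda>q r. r \<le> q) ?A)"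
      by (rule partial_order_on_relation_ofI) auto
    fix C assume "C \<in> Chains (relation_of (\<lambda>q r. r \<le> q) ?A)"
    then have C: "C \<subseteq> ?A" and chain: "\<And>q r. q \<in> C \<Longrightarrow> r \<in> C \<Longrightarrow> q \<le> r \<or> r \<le> q"
      by (auto simp: Chains_def relation_of_def)
    show "\<exists>u\<in>?A. \<forall>q\<in>C. u \<le> q"
    proof (cases "C = {}")
      case True
      then show ?thesis using p by auto
    next
      case False
      define u where "u = (\<lambda>x. INF q\<in>C. q x)"
      have bdd: "bdd_below ((\<lambda>q. q x) ` C)" for x
      proof (rule bdd_belowI2)
        fix q assume "q \<in> C"
        with C have "sublinear q" "q (- x) \<le> p (- x)" by (auto simp: le_fun_def)
        then show "- p (- x) \<le> q x" using sublinear_ge[of q x] by simp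
      qed
      have low: "u \<le> q" if "q \<in> C" for q
        unfolding u_def le_fun_def using bdd that by (auto intro: cINF_lower)
      have "sublinear u" unfolding u_def
      proof (rule sublinear_INF[OF False bdd])
        fix q r x y assume qr: "q \<in> C" "r \<in> C"
        then obtain s where s: "s \<in> C" "s \<le> q" "s \<le> r" using chain[OF qr] by blast
        then have "s (x + y) \<le> s x + s y" using C by (auto simp: sublinear_def)
        also have "\<dots> \<le> q x + r y" using s by (auto simp: le_fun_def intro: add_mono)
        finally show "\<exists>s\<in>C. s (x + y) \<le> q x + r y" using s by blast
      next
        fix q and c :: real and x assume "q \<in> C" "c > 0"
        then show "\<exists>r\<in>C. r (c *\<^sub>R x) \<le> c * q x"
          using C by (intro bexI[of _ q]) (auto simp: sublinear_def)
      next
        fix q assume "q \<in> C"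
        then show "q 0 = 0" using C sublinear_zero by auto
      qed
      moreover have "u \<le> p" using False low C by (blast intro: order_trans)
      ultimately show ?thesis using low by auto
    qed
  qed
  then obtain f where f: "sublinear f" "f \<le> p" and min: "\<And>r. sublinear r \<Longrightarrow> r \<le> f \<Longrightarrow> r = f"
    by (auto intro: order_trans)
  have add: "f (x + y) = f x + f y" for x y
  proof -
    obtain q where q: "sublinear q" "q \<le> f" "\<And>x. q x \<le> f (x + y) - f y"
      using sublinear_lower_at[OF f(1), of y] by blast
    then have "f x \<le> f (x + y) - f y" using min[of q] by auto
    moreover have "f (x + y) \<le> f x + f y" using f(1) by (simp add: sublinear_def)
    ultimately show ?thesis by simp
  qed
  have neg: "f (- x) = - f x" for x
    using add[of x "- x"] sublinear_zero[OF f(1)] by simp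
  have "f (c *\<^sub>R x) = c * f x" for c x
  proof (cases "c \<ge> 0")
    case True
    then show ?thesis using f(1) by (simp add: sublinear_def)
  next
    case False
    then have "f (c *\<^sub>R x) = f ((- c) *\<^sub>R (- x))" by simp
    also have "\<dots> = (- c) * f (- x)" using f(1) False unfolding sublinear_def by (metis linear neg_0_le_iff_le)
    finally show ?thesis by (simp add: neg)
  qed
  with add have "linear f" by (intro linearI) auto
  then show thesis using f(2) by (rule that)
qed

lemma real_norming_functional:
  fixes a :: "'a::real_normed_vector"
  obtains f where "linear f" "\<And>x. f x \<le> norm x" "f a = norm a"
proof -
  have "sublinear (norm :: 'a \<Rightarrow> real)" by (auto simp: sublinear_def norm_triangle_ineq)
  then obtain q where q: "sublinear q" "q \<le> norm" "\<And>x. q x \<le> norm (x + a) - norm a"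
    using sublinear_lower_at by blast
  obtain f where f: "linear f" "f \<le> q" using hahn_banach_sublinear[OF q(1)] by blast
  have le: "f x \<le> norm x" for x using f(2) q(2) by (meson le_fun_def order_trans)
  have "f (- a) \<le> - norm a" using le_funD[OF f(2), of "- a"] q(3)[of "- a"] by simp
  then have "norm a \<le> f a" using f(1) by (simp add: linear_neg)
  with le[of a] have "f a = norm a" by simp
  with f(1) le show thesis by (rule that)
qed

section \<open>Operators and functionals over the scalar field\<close>

lemma normed_space_over_mult: "normed_space_over ((*) :: 'k::real_or_complex \<Rightarrow> 'k \<Rightarrow> 'k)"
  by unfold_locales (auto simp: algebra_simps scaleR_conv_of_real norm_mult)

lemma ex_bounded_op:
  fixes sX :: "'k::real_or_complex \<Rightarrow> 'x::real_normed_vector \<Rightarrow> 'x"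
    and sY :: "'k \<Rightarrow> 'y::real_normed_vector \<Rightarrow> 'y"
  assumes "normed_space_over sX" "normed_space_over sY"
    and add: "\<And>x y. G (x + y) = G x + G y"
    and scale: "\<And>c x. G (sX c x) = sY c (G x)"
    and bound: "\<And>x. norm (G x) \<le> M * norm x" and "M \<ge> 0"
  obtains T where "T \<in> bounded_ops sX sY" "blinfun_apply T = G" "norm T \<le> M"
proof -
  have "G (r *\<^sub>R x) = r *\<^sub>R G x" for r x
    using scale[of "of_real r" x] assms(1,2) by (simp add: normed_space_over.scale_of_real)
  then have "bounded_linear G"
    using add bound by (intro bounded_linear_intro[of _ M]) (auto simp: mult.commute)
  then have G: "blinfun_apply (Blinfun G) = G" by (rule bounded_linear_Blinfun_apply)
  show thesis
  proof
    show "Blinfun G \<in> bounded_ops sX sY" by (simp add: bounded_ops_def G scale)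
    show "norm (Blinfun G) \<le> M" by (rule norm_blinfun_bound) (auto simp: G bound \<open>M \<ge> 0\<close>)
  qed (rule G)
qed

lemma dual_apply_scale: "f \<in> dual s \<Longrightarrow> blinfun_apply f (s c x) = c * blinfun_apply f x"
  by (simp add: dual_def bounded_ops_def)

lemma dual_diff: "f \<in> dual s \<Longrightarrow> g \<in> dual s \<Longrightarrow> f - g \<in> dual s"
  by (simp add: dual_def bounded_ops_def blinfun.diff_left right_diff_distrib)

lemma dual_add: "f \<in> dual s \<Longrightarrow> g \<in> dual s \<Longrightarrow> f + g \<in> dual s"
  by (simp add: dual_def bounded_ops_def blinfun.add_left distrib_left)

lemma dual_sum: "(\<And>i. i \<in> I \<Longrightarrow> f i \<in> dual s) \<Longrightarrow> (\<Sum>i\<in>I. f i) \<in> dual s"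
  by (simp add: dual_def bounded_ops_def blinfun.sum_left sum_distrib_left)

context normed_space_over
begin

text \<open>In the complex case this is the usual \<open>f x - i * f (i x)\<close>; in the real case every scalar equals its
real part.\<close>
lemma ex_functional_with_real_part:
  assumes f: "linear f"
  shows "\<exists>G :: 'a \<Rightarrow> 'k. (\<forall>x y. G (x + y) = G x + G y) \<and>
    (\<forall>c x. G (scale c x) = c * G x) \<and> (\<forall>x. re (G x) = f x)"
proof -
  note f_simps = linear_add[OF f] linear_scale[OF f]
  from range_emb[where 'k='k] show ?thesis
  proof
    assume "range (emb :: 'k \<Rightarrow> complex) = \<real>"
    then have "emb c = emb (of_real (re c) :: 'k)" for c :: 'k
      by (metis emb_of_real of_real_Re rangeI re_def)
    then have c: "c = of_real (re c)" for c :: 'k by (simp only: emb_eq_iff)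
    have "f (scale c x) = re c * f x" for c x
      by (subst c) (simp add: scale_of_real f_simps)
    then have "of_real (f (scale c x)) = c * of_real (f x)" for c x
      by (subst (3) c) simp
    then show ?thesis
      by (intro exI[of _ "\<lambda>x. of_real (f x)"]) (simp add: f_simps re_of_real)
  next
    assume "range (emb :: 'k \<Rightarrow> complex) = UNIV"
    then obtain i :: 'k where i: "emb i = \<i>" by (metis surjD)
    have "emb (i * i) = emb (- 1 :: 'k)"
      using emb_diff[of 0 "1 :: 'k"] emb_of_real[of 0, where 'a='k] by (simp add: emb_mult i emb_one)
    then have ii: "i * i = - 1" by (simp only: emb_eq_iff)
    have "emb c = emb (of_real (re c) + of_real (Im (emb c)) * i)" for c :: 'k
      by (simp add: emb_add emb_mult emb_of_real i re_def complex_eq_iff)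
    then have c: "c = of_real (re c) + of_real (Im (emb c)) * i" for c :: 'k by (simp only: emb_eq_iff)
    define G where "G x = of_real (f x) - i * of_real (f (scale i x))" for x
    have G_add: "G (x + y) = G x + G y" for x y
      by (simp add: G_def f_simps scale_right_distrib algebra_simps)
    have comm: "scale i (r *\<^sub>R x) = r *\<^sub>R scale i x" for r x
      by (simp add: mult.commute flip: scale_of_real)
    have G_real: "G (r *\<^sub>R x) = of_real r * G x" for r x
      by (simp add: G_def f_simps comm algebra_simps)
    have G_i: "G (scale i x) = i * G x" for x
    proof -
      have "scale i (scale i x) = (- 1) *\<^sub>R x" by (simp add: ii flip: scale_of_real)
      then have "f (scale i (scale i x)) = - f x" using f_simps(2)[of "- 1" x] by simp
      then show ?thesis
        by (simp add: G_def right_diff_distrib ii flip: mult.assoc)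
    qed
    have "G (scale c x) = c * G x" for c x
    proof -
      have "scale c x = re c *\<^sub>R x + Im (emb c) *\<^sub>R scale i x"
        by (subst c) (simp add: scale_left_distrib flip: scale_of_real)
      then have "G (scale c x) = (of_real (re c) + of_real (Im (emb c)) * i) * G x"
        by (simp add: G_add G_real G_i algebra_simps)
      then show ?thesis using c[of c] by simp
    qed
    moreover have "re (G x) = f x" for x
      by (simp add: G_def re_def emb_diff emb_mult emb_of_real i)
    ultimately show ?thesis using G_add by blast
  qed
qed

lemma ex_norming_functional:
  obtains f :: "'a \<Rightarrow>\<^sub>L 'k" where "f \<in> dual scale" "norm f \<le> 1" "f a = of_real (norm a)"
proof -
  obtain r where r: "linear r" "\<And>x. r x \<le> norm x" "r a = norm a"
    using real_norming_functional[of a] by blast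
  obtain G :: "'a \<Rightarrow> 'k" where add: "\<And>x y. G (x + y) = G x + G y"
    and scale: "\<And>c x. G (scale c x) = c * G x" and re: "\<And>x. re (G x) = r x"
    using ex_functional_with_real_part[OF r(1)] by blast
  have bound: "norm (G x) \<le> norm x" for x
  proof -
    obtain \<theta> where \<theta>: "norm \<theta> = 1" "\<theta> * G x = of_real (norm (G x))"
      using ex_rotation by blast
    have "norm (G x) = re (G (scale \<theta> x))" by (simp add: scale \<theta> re_of_real)
    also have "\<dots> \<le> norm (scale \<theta> x)" by (simp add: re r)
    finally show ?thesis by (simp add: norm_scale \<theta>)
  qed
  obtain f where "f \<in> dual scale" "blinfun_apply f = G" "norm f \<le> 1"
    using ex_bounded_op[of scale "(*)" G 1] normed_space_over_axioms normed_space_over_mult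
      add scale bound by (auto simp: dual_def)
  moreover have "G a = of_real (norm a)"
    using bound by (intro eq_of_real_if_re_max) (simp_all add: re r)
  ultimately show thesis using that by metis
qed

lemma ex_unit_functional:
  assumes "\<exists>a::'a. a \<noteq> 0"
  obtains f :: "'a \<Rightarrow>\<^sub>L 'k" where "f \<in> dual scale" "norm f = 1"
proof -
  obtain a :: 'a where a: "a \<noteq> 0" using assms by blast
  obtain f :: "'a \<Rightarrow>\<^sub>L 'k" where f: "f \<in> dual scale" "norm f \<le> 1" "f a = of_real (norm a)"
    by (rule ex_norming_functional)
  have "1 * norm a \<le> norm f * norm a" using norm_blinfun[of f a] f by simp
  then have "norm f = 1" using a f(2) by simp
  then show thesis using that f(1) by blast
qed

text \<open>The Banach-Alaoglu theorem: the bound places the ball in a product of compact balls of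
scalars, and linearity is a closed condition there.\<close>
lemma compact_dual_ball: "compact (blinfun_apply ` (dual scale \<inter> cball 0 1) :: ('a \<Rightarrow> 'k) set)"
proof -
  let ?P = "{g :: 'a \<Rightarrow> 'k. \<forall>x. g x \<in> cball 0 (norm x)}"
  have "compactin (product_topology (\<lambda>_. euclidean) UNIV) (PiE UNIV (\<lambda>x::'a. cball (0 :: 'k) (norm x)))"
    by (simp add: compactin_PiE compact_cball_scalar)
  moreover have "PiE UNIV (\<lambda>x::'a. cball (0 :: 'k) (norm x)) = ?P" by (auto simp: PiE_def Pi_def)
  ultimately have "compact ?P" by (simp add: euclidean_product_topology)
  moreover have "closed {g :: 'a \<Rightarrow> 'k. (\<forall>x y. g (x + y) = g x + g y) \<and> (\<forall>c x. g (scale c x) = c * g x)}"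
    by (intro closed_Collect_conj closed_Collect_all closed_Collect_eq continuous_intros
        continuous_on_product_coordinates)
  ultimately have "compact (?P \<inter>
      {g :: 'a \<Rightarrow> 'k. (\<forall>x y. g (x + y) = g x + g y) \<and> (\<forall>c x. g (scale c x) = c * g x)})"
    by (rule compact_Int_closed)
  also have "\<dots> = blinfun_apply ` (dual scale \<inter> cball 0 1)"
  proof safe
    fix g :: "'a \<Rightarrow> 'k"
    assume "\<forall>x. g x \<in> cball 0 (norm x)" "\<forall>x y. g (x + y) = g x + g y" "\<forall>c x. g (scale c x) = c * g x"
    then obtain T where "T \<in> dual scale" "blinfun_apply T = g" "norm T \<le> 1"
      using ex_bounded_op[OF normed_space_over_axioms normed_space_over_mult, of g 1]
      by (metis dual_def dist_0_norm mem_cball mult_1 zero_le_one)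
    then show "g \<in> blinfun_apply ` (dual scale \<inter> cball 0 1)" by auto
  next
    fix f :: "'a \<Rightarrow>\<^sub>L 'k" and x assume "f \<in> cball 0 1"
    then show "f x \<in> cball 0 (norm x)"
      using norm_blinfun[of f x] mult_right_mono[of "norm f" 1 "norm x"] by simp
  qed (auto simp: blinfun.add_right dual_apply_scale)
  finally show ?thesis .
qed

text \<open>The sum is a bounded projection \<open>P\<close> onto a finite-dimensional subspace, given in coordinates. It is
built by induction: a new vector \<open>b\<close> contributes \<open>b - P b\<close>, unless this is zero, together with a
functional that is \<open>1\<close> on it, corrected by composition with \<open>1 - P\<close> so that it vanishes on the old span.\<close>
lemma finite_span_coordinates:
  assumes "finite B"
  obtains n :: nat and e :: "nat \<Rightarrow> 'a" and f :: "nat \<Rightarrow> 'a \<Rightarrow>\<^sub>L 'k"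
  where "\<And>i. i < n \<Longrightarrow> e i \<in> span B" "\<And>i. i < n \<Longrightarrow> f i \<in> dual scale"
    "\<And>x. x \<in> span B \<Longrightarrow> (\<Sum>i<n. scale (f i x) (e i)) = x"
proof -
  have "\<exists>n e. \<exists>f :: nat \<Rightarrow> 'a \<Rightarrow>\<^sub>L 'k. (\<forall>i<n. e i \<in> span B \<and> f i \<in> dual scale) \<and>
      (\<forall>x\<in>span B. (\<Sum>i<n. scale (f i x) (e i)) = x)"
    using assms
  proof induction
    case empty
    then show ?case by (intro exI[of _ "0 :: nat"]) simp
  next
    case (insert b B)
    then obtain n e and f :: "nat \<Rightarrow> 'a \<Rightarrow>\<^sub>L 'k" where
      ef: "\<And>i. i < n \<Longrightarrow> e i \<in> span B" "\<And>i. i < n \<Longrightarrow> f i \<in> dual scale"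
      and id: "\<And>x. x \<in> span B \<Longrightarrow> (\<Sum>i<n. scale (f i x) (e i)) = x"
      by blast
    define P where "P x = (\<Sum>i<n. scale (f i x) (e i))" for x
    have P_add: "P (x + y) = P x + P y" for x y
      by (simp add: P_def blinfun.add_right scale_left_distrib sum.distrib)
    have P_diff: "P (x - y) = P x - P y" for x y
      using P_add[of "x - y" y] by simp
    have P_scale: "P (scale c x) = scale c (P x)" for c x
      using ef(2) by (simp add: P_def dual_apply_scale scale_sum_right)
    have P_span: "P x \<in> span B" for x
      unfolding P_def using ef(1) by (intro span_sum span_scale) auto
    have P_id: "P x = x" if "x \<in> span B" for x using id[OF that] by (simp add: P_def)
    define b' where "b' = b - P b"
    show ?case
    proof (cases "b' = 0")
      case True
      then have "b \<in> span B" using P_span[of b] by (simp add: b'_def)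
      then have "span (insert b B) = span B" by (rule span_redundant)
      then show ?thesis using ef id by metis
    next
      case False
      obtain h :: "'a \<Rightarrow>\<^sub>L 'k" where h: "h \<in> dual scale" "h b' = of_real (norm b')"
        by (rule ex_norming_functional)
      define g where "g = dual_scale (inverse (of_real (norm b'))) (h - (\<Sum>i<n. dual_scale (h (e i)) (f i)))"
      have g_dual: "g \<in> dual scale"
        unfolding g_def using h(1) ef(2)
        by (intro dual_scale_in_dual dual_diff dual_sum) auto
      have g_eq: "g x = inverse (of_real (norm b')) * (h x - h (P x))" for x
        using h(1) by (simp add: g_def dual_scale_apply blinfun.diff_left blinfun.sum_left P_def
            blinfun.sum_right dual_apply_scale mult.commute)
      have "P b' = 0" using P_id[OF P_span, of b] by (simp add: b'_def P_diff)
      then have g_b': "g b' = 1" using False h(2) by (simp add: g_eq)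
      have g_B: "g x = 0" if "x \<in> span B" for x using P_id[OF that] by (simp add: g_eq)
      define e' where "e' = e(n := b')"
      define f' where "f' = f(n := g)"
      have P': "(\<Sum>i<Suc n. scale (f' i x) (e' i)) = P x + scale (g x) b'" for x
        by (simp add: P_def e'_def f'_def)
      have mono: "span B \<subseteq> span (insert b B)" by (rule span_mono) auto
      have "b' \<in> span (insert b B)"
        unfolding b'_def using P_span[of b] mono by (blast intro: span_diff span_base)
      then have "\<forall>i<Suc n. e' i \<in> span (insert b B) \<and> f' i \<in> dual scale"
        using ef g_dual mono by (auto simp: e'_def f'_def less_Suc_eq)
      moreover have "(\<Sum>i<Suc n. scale (f' i x) (e' i)) = x" if x_span: "x \<in> span (insert b B)" for x
      proof -
        obtain k where k: "x - scale k b \<in> span B" using x_span by (auto simp: span_breakdown_eq)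
        define y where "y = x - scale k b + scale k (P b)"
        have y: "y \<in> span B" unfolding y_def using k P_span by (intro span_add span_scale)
        have x: "x = y + scale k b'" by (simp add: y_def b'_def scale_right_diff_distrib)
        show ?thesis
          unfolding P' using y g_dual
          by (simp add: x P_add P_scale \<open>P b' = 0\<close> P_id blinfun.add_right g_B g_b' dual_apply_scale)
      qed
      ultimately show ?thesis by blast
    qed
  qed
  then show thesis using that by blast
qed

end

section \<open>Adjoints of finite-rank operators\<close>

lemma norm_blinfun_le_on_ball:
  assumes "\<And>x. norm x \<le> 1 \<Longrightarrow> norm (blinfun_apply f x) \<le> b"
  shows "norm f \<le> b"
proof (rule norm_blinfun_bound)
  show "0 \<le> b" using assms[of 0] by simp
  show "norm (f x) \<le> b * norm x" for x
  proof (cases "x = 0")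
    case False
    then have "norm (f (inverse (norm x) *\<^sub>R x)) \<le> b" by (intro assms) simp
    then show ?thesis using False by (simp add: blinfun.scaleR_right field_simps)
  qed simp
qed

lemma norm_apply_le_of_ball:
  assumes "norm f \<le> 1" shows "norm (blinfun_apply f x) \<le> norm x"
  using norm_blinfun[of f x] mult_right_mono[OF assms, of "norm x"] by simp

lemma norm_dual_scale: "norm (dual_scale c f) = norm c * norm f"
  by (rule normed_space_over.norm_scale[OF normed_space_over_dual])

lemma bounded_bilinear_dual_scale: "bounded_bilinear dual_scale"
proof
  show "\<exists>K. \<forall>a b. norm (dual_scale a b :: 'b \<Rightarrow>\<^sub>L 'a) \<le> norm a * norm b * K"
    by (intro exI[of _ 1]) (simp add: norm_dual_scale)
qed (auto intro!: blinfun_eqI simp: dual_scale_apply blinfun.add_left blinfun.scaleR_left algebra_simps)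

lemmas continuous_on_dual_scale [continuous_intros] =
  bounded_bilinear.continuous_on[OF bounded_bilinear_dual_scale]

lemmas tendsto_dual_scale [tendsto_intros] =
  bounded_bilinear.tendsto[OF bounded_bilinear_dual_scale]

lemma adjoint_op_apply: "blinfun_apply (adjoint_op R f) x = f (R x)"
  by (simp add: adjoint_op_def)

lemma adjoint_op_dual_scale: "adjoint_op R (dual_scale c f) = dual_scale c (adjoint_op R f)"
  by (rule blinfun_eqI) (simp add: adjoint_op_apply dual_scale_apply)

lemma adjoint_op_diff_left: "adjoint_op (R - S) f = adjoint_op R f - adjoint_op S f"
  by (rule blinfun_eqI) (simp add: adjoint_op_apply blinfun.diff_left blinfun.diff_right)

lemma op_norm_on_eq_max:
  assumes "y0 \<in> V" "norm y0 \<le> 1" "\<And>y. y \<in> V \<Longrightarrow> norm y \<le> 1 \<Longrightarrow> norm (T y) \<le> norm (T y0)"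
  shows "op_norm_on V T = norm (T y0)"
  unfolding op_norm_on_def using assms by (intro cSup_eq_maximum) auto

locale normed_space_pair = X: normed_space_over sX + Y: normed_space_over sY
  for sX :: "'k::real_or_complex \<Rightarrow> 'x::real_normed_vector \<Rightarrow> 'x"
    and sY :: "'k \<Rightarrow> 'y::real_normed_vector \<Rightarrow> 'y"
begin

lemma ex_finite_rank_op:
  fixes c :: "nat \<Rightarrow> 'x \<Rightarrow>\<^sub>L 'k" and e :: "nat \<Rightarrow> 'y"
  assumes c: "\<And>i. i < n \<Longrightarrow> c i \<in> dual sX"
  obtains R where "R \<in> finite_rank_ops sX sY" "\<And>u. blinfun_apply R u = (\<Sum>i<n. sY (c i u) (e i))"
proof -
  have "norm (\<Sum>i<n. sY (c i u) (e i)) \<le> (\<Sum>i<n. norm (c i) * norm (e i)) * norm u" for u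
    unfolding sum_distrib_right
  proof (rule sum_norm_le)
    show "norm (sY (c i u) (e i)) \<le> norm (c i) * norm (e i) * norm u" for i
      using mult_right_mono[OF norm_blinfun[of "c i" u], of "norm (e i)"]
      by (simp add: Y.norm_scale mult_ac)
  qed
  moreover have "(\<Sum>i<n. norm (c i) * norm (e i)) \<ge> 0" by (intro sum_nonneg) auto
  moreover have "(\<Sum>i<n. sY (c i (u + v)) (e i)) = (\<Sum>i<n. sY (c i u) (e i)) + (\<Sum>i<n. sY (c i v) (e i))"
    for u v by (simp add: blinfun.add_right Y.scale_left_distrib sum.distrib)
  moreover have "(\<Sum>i<n. sY (c i (sX a u)) (e i)) = sY a (\<Sum>i<n. sY (c i u) (e i))" for a u
    using c by (simp add: Y.scale_sum_right dual_apply_scale)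
  ultimately obtain R where R: "R \<in> bounded_ops sX sY" "blinfun_apply R = (\<lambda>u. \<Sum>i<n. sY (c i u) (e i))"
    using ex_bounded_op[OF X.normed_space_over_axioms Y.normed_space_over_axioms,
        of "\<lambda>u. \<Sum>i<n. sY (c i u) (e i)" "\<Sum>i<n. norm (c i) * norm (e i)"]
    by blast
  have "range (blinfun_apply R) \<subseteq> Y.span (e ` {..<n})"
    unfolding R(2) image_subset_iff
    by (intro ballI Y.span_sum Y.span_scale Y.span_base imageI)
  then have "R \<in> finite_rank_ops sX sY" using R(1) by (auto simp: finite_rank_ops_def)
  then show thesis using that R(2) by metis
qed

lemma finite_rank_op_coordinates:
  assumes "R \<in> finite_rank_ops sX sY"
  obtains n :: nat and c :: "nat \<Rightarrow> 'x \<Rightarrow>\<^sub>L 'k" and e :: "nat \<Rightarrow> 'y"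
  where "\<And>i. i < n \<Longrightarrow> c i \<in> dual sX" "\<And>u. blinfun_apply R u = (\<Sum>i<n. sY (c i u) (e i))"
proof -
  obtain B where R: "R \<in> bounded_ops sX sY" and B: "finite B" "range (blinfun_apply R) \<subseteq> Y.span B"
    using assms by (auto simp: finite_rank_ops_def)
  obtain n :: nat and e and f :: "nat \<Rightarrow> 'y \<Rightarrow>\<^sub>L 'k" where f: "\<And>i. i < n \<Longrightarrow> f i \<in> dual sY"
    and id: "\<And>x. x \<in> Y.span B \<Longrightarrow> (\<Sum>i<n. sY (f i x) (e i)) = x"
    using Y.finite_span_coordinates[OF B(1)] by metis
  show thesis
  proof
    show "adjoint_op R (f i) \<in> dual sX" if "i < n" for i
      using R f[OF that] by (rule adjoint_op_in_dual)
    show "blinfun_apply R u = (\<Sum>i<n. sY (adjoint_op R (f i) u) (e i))" for u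
      using id[of "R u", OF subsetD[OF B(2) rangeI]] by (simp add: adjoint_op_apply)
  qed
qed

lemma adjoint_op_coordinates:
  fixes c :: "nat \<Rightarrow> 'x \<Rightarrow>\<^sub>L 'k"
  assumes "\<And>u. blinfun_apply R u = (\<Sum>i<n. sY (c i u) (e i))" "f \<in> dual sY"
  shows "adjoint_op R f = (\<Sum>i<n. dual_scale (f (e i)) (c i))"
  using assms(2)
  by (intro blinfun_eqI)
    (simp add: adjoint_op_apply assms(1) blinfun.sum_right blinfun.sum_left dual_apply_scale
      dual_scale_apply mult.commute)

section \<open>Perturbation to a range strongly exposing adjoint\<close>

text \<open>The gap forces the rotated coordinates of a norming sequence to converge to those of \<open>y0\<close>. The
rotations have a convergent subsequence with limit \<open>t\<close>, and undoing them gives convergence of the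
images to the rotation of the image of \<open>y0\<close> by \<open>inverse t\<close>.\<close>
lemma range_strongly_exposing_adjoint_if_gap:
  fixes c :: "nat \<Rightarrow> 'x \<Rightarrow>\<^sub>L 'k"
  assumes Rc: "\<And>u. blinfun_apply R u = (\<Sum>i<n. sY (c i u) (e i))"
    and Y: "\<exists>y::'y. y \<noteq> 0" and "\<delta> > 0"
    and y0: "y0 \<in> dual sY" "norm y0 \<le> 1"
    and gap: "\<And>y. y \<in> dual sY \<Longrightarrow> norm y \<le> 1 \<Longrightarrow> \<exists>\<theta>. norm \<theta> = 1 \<and>
      norm (adjoint_op R y) + \<delta> * (\<Sum>i<n. (norm (\<theta> * y (e i) - y0 (e i)))\<^sup>2) \<le> norm (adjoint_op R y0)"
  shows "range_strongly_exposing dual_scale (dual sY) (adjoint_op R :: ('y \<Rightarrow>\<^sub>L 'k) \<Rightarrow> ('x \<Rightarrow>\<^sub>L 'k))"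
proof -
  let ?T = "adjoint_op R :: ('y \<Rightarrow>\<^sub>L 'k) \<Rightarrow> ('x \<Rightarrow>\<^sub>L 'k)"
  define G where "G \<theta> y = (\<Sum>i<n. (norm (\<theta> * blinfun_apply y (e i) - y0 (e i)))\<^sup>2)" for \<theta> and y :: "'y \<Rightarrow>\<^sub>L 'k"
  have G_nonneg: "G \<theta> y \<ge> 0" for \<theta> y unfolding G_def by (intro sum_nonneg) auto
  have gap': "\<exists>\<theta>. norm \<theta> = 1 \<and> norm (?T y) + \<delta> * G \<theta> y \<le> norm (?T y0)"
    if "y \<in> dual sY" "norm y \<le> 1" for y
    using gap[OF that] by (simp add: G_def)
  have max: "norm (?T y) \<le> norm (?T y0)" if y: "y \<in> dual sY" "norm y \<le> 1" for y
  proof -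
    obtain \<theta> where "norm (?T y) + \<delta> * G \<theta> y \<le> norm (?T y0)" using gap'[OF y] by blast
    moreover have "\<delta> * G \<theta> y \<ge> 0" using G_nonneg \<open>\<delta> > 0\<close> by simp
    ultimately show ?thesis by simp
  qed
  have N: "op_norm_on (dual sY) ?T = norm (?T y0)" by (rule op_norm_on_eq_max[where T = ?T, OF y0 max])
  show ?thesis
  proof (cases "?T y0 = 0")
    case True
    \<comment> \<open>Here the adjoint vanishes on the dual and \<open>y0\<close> may be zero, so any unit functional serves.\<close>
    then have zero: "?T y = 0" if "y \<in> dual sY" "norm y \<le> 1" for y using max[OF that] by simp
    obtain u :: "'y \<Rightarrow>\<^sub>L 'k" where "u \<in> dual sY" "norm u = 1" by (rule Y.ex_unit_functional[OF Y])
    then show ?thesis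
      unfolding range_strongly_exposing_def
      by (intro bexI[of _ u] conjI allI impI exI[of _ id] exI[of _ 1])
        (auto simp: zero strict_mono_def dual_scale_def)
  next
    case False
    then have "norm (?T y0) > 0" by simp
    have "y0 \<noteq> 0" using False by (auto simp: adjoint_op_def)
    \<comment> \<open>Normalising \<open>y0\<close> cannot increase the maximum, so \<open>y0\<close> already lies on the sphere.\<close>
    have "norm (?T (dual_scale (of_real (inverse (norm y0))) y0)) \<le> norm (?T y0)"
      using y0 \<open>y0 \<noteq> 0\<close> by (intro max dual_scale_in_dual) (auto simp: norm_dual_scale norm_inverse)
    then have "inverse (norm y0) * norm (?T y0) \<le> 1 * norm (?T y0)"
      by (simp add: adjoint_op_dual_scale norm_dual_scale norm_inverse)
    then have "inverse (norm y0) \<le> 1" using \<open>norm (?T y0) > 0\<close> mult_le_cancel_right_pos by blast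
    then have "norm y0 = 1" using y0(2) \<open>y0 \<noteq> 0\<close> by (simp add: inverse_le_1_iff)
    moreover have "\<exists>\<sigma> \<theta>. strict_mono (\<sigma> :: nat \<Rightarrow> nat) \<and> norm \<theta> = 1 \<and>
        (\<lambda>k. ?T (y (\<sigma> k))) \<longlonglongrightarrow> dual_scale \<theta> (?T y0)"
      if y: "\<And>k. y k \<in> dual sY \<inter> cball 0 1" and lim: "(\<lambda>k. norm (?T (y k))) \<longlonglongrightarrow> op_norm_on (dual sY) ?T"
      for y
    proof -
      have "\<exists>\<theta>. norm \<theta> = 1 \<and> norm (?T (y k)) + \<delta> * G \<theta> (y k) \<le> norm (?T y0)" for k
        using y[of k] by (intro gap') auto
      then obtain \<theta> where \<theta>: "\<And>k. norm (\<theta> k) = 1"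
        and le: "\<And>k. norm (?T (y k)) + \<delta> * G (\<theta> k) (y k) \<le> norm (?T y0)" by metis
      have "(\<lambda>k. (norm (?T y0) - norm (?T (y k))) / \<delta>) \<longlonglongrightarrow> (norm (?T y0) - norm (?T y0)) / \<delta>"
        using \<open>\<delta> > 0\<close> by (intro tendsto_divide tendsto_diff tendsto_const lim[unfolded N]) auto
      then have bound_lim: "(\<lambda>k. (norm (?T y0) - norm (?T (y k))) / \<delta>) \<longlonglongrightarrow> 0" by simp
      have G_lim: "(\<lambda>k. G (\<theta> k) (y k)) \<longlonglongrightarrow> 0"
      proof (rule tendsto_sandwich[OF _ _ tendsto_const bound_lim])
        show "\<forall>\<^sub>F k in sequentially. G (\<theta> k) (y k) \<le> (norm (?T y0) - norm (?T (y k))) / \<delta>"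
          using le \<open>\<delta> > 0\<close> by (auto simp: pos_le_divide_eq algebra_simps)
      qed (use G_nonneg in auto)
      have coord_lim: "(\<lambda>k. \<theta> k * y k (e i)) \<longlonglongrightarrow> y0 (e i)" if "i < n" for i
      proof -
        have "(\<lambda>k. (norm (\<theta> k * y k (e i) - y0 (e i)))\<^sup>2) \<longlonglongrightarrow> 0"
        proof (rule tendsto_sandwich[OF _ _ tendsto_const G_lim])
          show "\<forall>\<^sub>F k in sequentially. (norm (\<theta> k * y k (e i) - y0 (e i)))\<^sup>2 \<le> G (\<theta> k) (y k)"
            unfolding G_def using that by (intro always_eventually allI member_le_sum) auto
        qed auto
        then show ?thesis
          by (simp add: tendsto_norm_zero_iff flip: LIM_zero_iff[of _ "y0 (e i)"])
      qed
      have "seq_compact (cball (0 :: 'k) 1)"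
        using compact_cball_scalar compact_imp_seq_compact by blast
      moreover have "\<forall>k. \<theta> k \<in> cball 0 1" using \<theta> by simp
      ultimately obtain t \<sigma> where \<sigma>: "strict_mono (\<sigma> :: nat \<Rightarrow> nat)" and t: "(\<theta> \<circ> \<sigma>) \<longlonglongrightarrow> t"
        unfolding seq_compact_def by blast
      have "(\<lambda>k. norm ((\<theta> \<circ> \<sigma>) k)) \<longlonglongrightarrow> norm t" using t by (rule tendsto_norm)
      then have nt: "norm t = 1" using \<theta> by (simp add: LIMSEQ_const_iff)
      have coord_lim': "(\<lambda>k. y (\<sigma> k) (e i)) \<longlonglongrightarrow> inverse t * y0 (e i)" if "i < n" for i
      proof -
        have "t \<noteq> 0" using nt by auto
        then have "(\<lambda>k. inverse ((\<theta> \<circ> \<sigma>) k) * (((\<lambda>k. \<theta> k * y k (e i)) \<circ> \<sigma>) k)) \<longlonglongrightarrow> inverse t * y0 (e i)"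
          by (rule tendsto_mult[OF tendsto_inverse[OF t] LIMSEQ_subseq_LIMSEQ[OF coord_lim[OF that] \<sigma>]])
        moreover have "inverse ((\<theta> \<circ> \<sigma>) k) * (((\<lambda>k. \<theta> k * y k (e i)) \<circ> \<sigma>) k) = y (\<sigma> k) (e i)" for k
        proof -
          have "\<theta> (\<sigma> k) \<noteq> 0" using \<theta>[of "\<sigma> k"] by auto
          then show ?thesis by (simp flip: mult.assoc)
        qed
        ultimately show ?thesis by (simp only:)
      qed
      have "(\<lambda>k. \<Sum>i<n. dual_scale (y (\<sigma> k) (e i)) (c i)) \<longlonglongrightarrow> (\<Sum>i<n. dual_scale (inverse t * y0 (e i)) (c i))"
        using coord_lim' by (intro tendsto_intros) auto
      moreover have "?T (y (\<sigma> k)) = (\<Sum>i<n. dual_scale (y (\<sigma> k) (e i)) (c i))" for k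
        using y by (intro adjoint_op_coordinates[OF Rc]) auto
      moreover have "dual_scale (inverse t) (?T y0) = (\<Sum>i<n. dual_scale (inverse t * y0 (e i)) (c i))"
        using adjoint_op_coordinates[OF Rc dual_scale_in_dual[OF y0(1)], of "inverse t"]
        by (simp add: adjoint_op_dual_scale dual_scale_apply)
      ultimately have "(\<lambda>k. ?T (y (\<sigma> k))) \<longlonglongrightarrow> dual_scale (inverse t) (?T y0)" by simp
      moreover have "norm (inverse t) = 1" using nt by (simp add: norm_inverse)
      ultimately show ?thesis using \<sigma> by blast
    qed
    ultimately show ?thesis unfolding range_strongly_exposing_def using y0(1) by blast
  qed
qed

text \<open>The adjoint of a finite-rank operator depends on finitely many point values, so the quantity to be
maximised is continuous on the dual ball in the topology of pointwise convergence.\<close>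
lemma ex_maximal_functional:
  fixes c :: "nat \<Rightarrow> 'x \<Rightarrow>\<^sub>L 'k"
  assumes Rc: "\<And>u. blinfun_apply R u = (\<Sum>i<n. sY (c i u) (e i))"
  obtains y0 :: "'y \<Rightarrow>\<^sub>L 'k" where "y0 \<in> dual sY" "norm y0 \<le> 1"
    "\<And>y. y \<in> dual sY \<Longrightarrow> norm y \<le> 1 \<Longrightarrow>
      norm (adjoint_op R y) + \<delta> * (\<Sum>i<n. (norm (y (e i)))\<^sup>2)
      \<le> norm (adjoint_op R y0) + \<delta> * (\<Sum>i<n. (norm (y0 (e i)))\<^sup>2)"
proof -
  let ?D = "blinfun_apply ` (dual sY \<inter> cball 0 1) :: ('y \<Rightarrow> 'k) set"
  let ?F = "\<lambda>g. norm (\<Sum>i<n. dual_scale (g (e i)) (c i)) + \<delta> * (\<Sum>i<n. (norm (g (e i) :: 'k))\<^sup>2)"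
  have "(0 :: 'y \<Rightarrow>\<^sub>L 'k) \<in> dual sY \<inter> cball 0 1" by (simp add: dual_def bounded_ops_def)
  then have "?D \<noteq> {}" by blast
  moreover have "continuous_on ?D ?F"
    by (intro continuous_intros continuous_on_subset[OF continuous_on_product_coordinates]) auto
  ultimately obtain g where g: "g \<in> ?D" and max: "\<And>h. h \<in> ?D \<Longrightarrow> ?F h \<le> ?F g"
    using continuous_attains_sup[OF Y.compact_dual_ball, of ?F] by blast
  from g obtain y0 where y0: "y0 \<in> dual sY" "norm y0 \<le> 1" "g = blinfun_apply y0" by auto
  show thesis
  proof
    fix y :: "'y \<Rightarrow>\<^sub>L 'k" assume y: "y \<in> dual sY" "norm y \<le> 1"
    then have "?F (blinfun_apply y) \<le> ?F (blinfun_apply y0)" using max y0(3) by auto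
    then show "norm (adjoint_op R y) + \<delta> * (\<Sum>i<n. (norm (y (e i)))\<^sup>2)
      \<le> norm (adjoint_op R y0) + \<delta> * (\<Sum>i<n. (norm (y0 (e i)))\<^sup>2)"
      using y(1) y0(1) by (simp add: adjoint_op_coordinates[OF Rc])
  qed (use y0 in auto)
qed

text \<open>The perturbation adds \<open>2 * \<delta>\<close> times the rank-one operator with functional \<open>v\<close>, the direction of the
adjoint image of the maximiser \<open>y0\<close>, and vector \<open>w = (\<Sum>i<n. sY (cj (y0 (e i))) (e i))\<close>. In
coordinates only the functionals \<open>c i\<close> change, and \<open>q y\<close> below is the value \<open>y w\<close>. The factor \<open>2\<close>
matches the linear term in the expansion of the square.\<close>
lemma ex_range_strongly_exposing_near:
  fixes c :: "nat \<Rightarrow> 'x \<Rightarrow>\<^sub>L 'k"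
  assumes c: "\<And>i. i < n \<Longrightarrow> c i \<in> dual sX"
    and Rc: "\<And>u. blinfun_apply R u = (\<Sum>i<n. sY (c i u) (e i))"
    and X: "\<exists>x::'x. x \<noteq> 0" and Y: "\<exists>y::'y. y \<noteq> 0" and "\<delta> > 0"
  obtains R' where "R' \<in> finite_rank_ops sX sY"
    "range_strongly_exposing dual_scale (dual sY) (adjoint_op R' :: ('y \<Rightarrow>\<^sub>L 'k) \<Rightarrow> ('x \<Rightarrow>\<^sub>L 'k))"
    "norm (R' - R) \<le> 2 * \<delta> * (\<Sum>i<n. (norm (e i))\<^sup>2)"
proof -
  obtain y0 :: "'y \<Rightarrow>\<^sub>L 'k" where y0: "y0 \<in> dual sY" "norm y0 \<le> 1"
    and max: "\<And>y. y \<in> dual sY \<Longrightarrow> norm y \<le> 1 \<Longrightarrow>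
      norm (adjoint_op R y) + \<delta> * (\<Sum>i<n. (norm (y (e i)))\<^sup>2)
      \<le> norm (adjoint_op R y0) + \<delta> * (\<Sum>i<n. (norm (y0 (e i)))\<^sup>2)"
    using ex_maximal_functional[OF Rc] by blast
  define z where "z = adjoint_op R y0"
  have z: "z \<in> dual sX"
    unfolding z_def adjoint_op_coordinates[OF Rc y0(1)] using c by (intro dual_sum dual_scale_in_dual) auto
  obtain v where v: "v \<in> dual sX" "norm v = 1" "dual_scale (of_real (norm z)) v = z"
  proof (cases "z = 0")
    case True
    \<comment> \<open>Every direction is then admissible, since \<open>norm z * v = z\<close> holds for all unit functionals \<open>v\<close>.\<close>
    obtain v :: "'x \<Rightarrow>\<^sub>L 'k" where "v \<in> dual sX" "norm v = 1" by (rule X.ex_unit_functional[OF X])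
    moreover from True have "dual_scale (of_real (norm z)) v = z"
      by (intro blinfun_eqI) (simp add: dual_scale_apply)
    ultimately show thesis by (rule that)
  next
    case False
    then have "norm z \<noteq> 0" by simp
    then have "dual_scale (of_real (norm z)) (dual_scale (of_real (inverse (norm z))) z) = z"
      by (intro blinfun_eqI) (simp add: dual_scale_apply flip: mult.assoc)
    moreover have "norm (dual_scale (of_real (inverse (norm z))) z) = 1"
      using \<open>norm z \<noteq> 0\<close> by (simp add: norm_dual_scale norm_inverse)
    ultimately show thesis using that dual_scale_in_dual[OF z] by blast
  qed
  define q where "q y = (\<Sum>i<n. cj (y0 (e i)) * blinfun_apply y (e i))" for y
  define s where "s = (\<Sum>i<n. (norm (y0 (e i)))\<^sup>2)"
  have q_y0: "q y0 = of_real s" by (simp add: q_def s_def cj_mult_self)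
  define c' where "c' i = c i + dual_scale (of_real (2 * \<delta>) * cj (y0 (e i))) v" for i
  obtain R' where R': "R' \<in> finite_rank_ops sX sY"
    and R'c: "\<And>u. blinfun_apply R' u = (\<Sum>i<n. sY (c' i u) (e i))"
  proof -
    have "c' i \<in> dual sX" if "i < n" for i
      unfolding c'_def using c[OF that] v(1) by (intro dual_add dual_scale_in_dual)
    then show thesis using ex_finite_rank_op[of n c' e] that by blast
  qed
  have adj: "adjoint_op R' y = adjoint_op R y + dual_scale (of_real (2 * \<delta>) * q y) v"
    if "y \<in> dual sY" for y
  proof (rule blinfun_eqI)
    fix u
    have "adjoint_op R' y u = (\<Sum>i<n. y (e i) * c i u + of_real (2 * \<delta>) * (cj (y0 (e i)) * y (e i)) * v u)"
      by (simp add: adjoint_op_coordinates[OF R'c that] c'_def blinfun.sum_left dual_scale_apply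
          blinfun.add_left algebra_simps)
    also have "\<dots> = (adjoint_op R y + dual_scale (of_real (2 * \<delta>) * q y) v) u"
      by (simp add: adjoint_op_coordinates[OF Rc that] q_def blinfun.sum_left dual_scale_apply
          blinfun.add_left sum.distrib sum_distrib_left sum_distrib_right)
    finally show "adjoint_op R' y u = \<dots>" .
  qed
  have "s \<ge> 0" unfolding s_def by (intro sum_nonneg) auto
  have norm_y0: "norm (adjoint_op R' y0) = norm z + 2 * \<delta> * s"
  proof -
    have "adjoint_op R' y0 = dual_scale (of_real (norm z + 2 * \<delta> * s)) v"
      unfolding adj[OF y0(1)] q_y0 z_def[symmetric]
      by (subst (1) v(3)[symmetric]) (auto intro!: blinfun_eqI simp: dual_scale_apply blinfun.add_left algebra_simps)
    then show ?thesis using \<open>\<delta> > 0\<close> \<open>s \<ge> 0\<close> v(2) by (simp add: norm_dual_scale del: of_real_add)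
  qed
  show thesis
  proof
    show "R' \<in> finite_rank_ops sX sY" by (rule R')
    show "range_strongly_exposing dual_scale (dual sY) (adjoint_op R' :: ('y \<Rightarrow>\<^sub>L 'k) \<Rightarrow> ('x \<Rightarrow>\<^sub>L 'k))"
    proof (rule range_strongly_exposing_adjoint_if_gap[OF R'c Y \<open>\<delta> > 0\<close> y0])
      fix y :: "'y \<Rightarrow>\<^sub>L 'k" assume y: "y \<in> dual sY" "norm y \<le> 1"
      obtain \<theta> where \<theta>: "norm \<theta> = 1" "\<theta> * q y = of_real (norm (q y))" using ex_rotation by blast
      let ?g = "\<Sum>i<n. (norm (\<theta> * y (e i) - y0 (e i)))\<^sup>2"
      have "(\<Sum>i<n. (norm (\<theta> * y (e i)))\<^sup>2)
          = (\<Sum>i<n. (norm (y0 (e i)))\<^sup>2 + 2 * re (cj (y0 (e i)) * (\<theta> * y (e i) - y0 (e i)))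
              + (norm (\<theta> * y (e i) - y0 (e i)))\<^sup>2)"
        by (intro sum.cong refl norm_square_expand)
      also have "\<dots> = s + 2 * re (\<Sum>i<n. cj (y0 (e i)) * (\<theta> * y (e i) - y0 (e i))) + ?g"
        by (simp add: sum.distrib s_def re_simps sum_distrib_left)
      also have "(\<Sum>i<n. cj (y0 (e i)) * (\<theta> * y (e i) - y0 (e i))) = \<theta> * q y - q y0"
        by (simp add: q_def sum_distrib_left algebra_simps sum_subtractf)
      also have "re (\<theta> * q y - q y0) = norm (q y) - s"
        by (simp add: \<theta> q_y0 re_simps re_of_real)
      \<comment> \<open>The rotation by \<open>\<theta>\<close> makes the linear term of the expansion equal to the norm of \<open>q y\<close>.\<close>
      finally have square: "(\<Sum>i<n. (norm (\<theta> * y (e i)))\<^sup>2) = s + 2 * (norm (q y) - s) + ?g" .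
      have "norm (adjoint_op R y) + \<delta> * (\<Sum>i<n. (norm (\<theta> * y (e i)))\<^sup>2) \<le> norm z + \<delta> * s"
        using max[of "dual_scale \<theta> y"] y \<theta>(1)
        by (simp add: dual_scale_in_dual norm_dual_scale adjoint_op_dual_scale dual_scale_apply z_def s_def)
      then have "norm (adjoint_op R y) + 2 * \<delta> * norm (q y) + \<delta> * ?g \<le> norm z + 2 * \<delta> * s"
        unfolding square by (simp add: algebra_simps)
      moreover have "norm (adjoint_op R' y) \<le> norm (adjoint_op R y) + 2 * \<delta> * norm (q y)"
        unfolding adj[OF y(1)] using \<open>\<delta> > 0\<close> v(2)
        by (intro order_trans[OF norm_triangle_ineq]) (simp add: norm_dual_scale norm_mult)
      ultimately have "norm (adjoint_op R' y) + \<delta> * ?g \<le> norm (adjoint_op R' y0)"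
        by (simp add: norm_y0)
      then show "\<exists>\<theta>. norm \<theta> = 1 \<and>
          norm (adjoint_op R' y) + \<delta> * (\<Sum>i<n. (norm (\<theta> * y (e i) - y0 (e i)))\<^sup>2) \<le> norm (adjoint_op R' y0)"
        using \<theta>(1) by blast
    qed
    show "norm (R' - R) \<le> 2 * \<delta> * (\<Sum>i<n. (norm (e i))\<^sup>2)"
    proof (rule norm_blinfun_le_on_ball)
      fix u :: 'x assume u: "norm u \<le> 1"
      have "(R' - R) u = (\<Sum>i<n. sY (of_real (2 * \<delta>) * cj (y0 (e i)) * v u) (e i))"
        by (simp add: blinfun.diff_left R'c Rc c'_def blinfun.add_left dual_scale_apply
            Y.scale_left_distrib sum.distrib)
      also have "norm \<dots> \<le> (\<Sum>i<n. 2 * \<delta> * (norm (e i))\<^sup>2)"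
      proof (rule sum_norm_le)
        fix i
        have "norm (v u) \<le> 1" using norm_apply_le_of_ball[of v u] v(2) u by simp
        moreover have "norm (y0 (e i)) \<le> norm (e i)" using y0(2) by (rule norm_apply_le_of_ball)
        ultimately have "norm (y0 (e i)) * norm (v u) \<le> norm (e i) * 1" by (intro mult_mono) auto
        then have "norm (y0 (e i)) * norm (v u) * norm (e i) \<le> norm (e i) * norm (e i)"
          by (intro mult_right_mono) auto
        then have "2 * \<delta> * (norm (y0 (e i)) * norm (v u) * norm (e i)) \<le> 2 * \<delta> * (norm (e i) * norm (e i))"
          using \<open>\<delta> > 0\<close> by (intro mult_left_mono) auto
        then show "norm (sY (of_real (2 * \<delta>) * cj (y0 (e i)) * v u) (e i)) \<le> 2 * \<delta> * (norm (e i))\<^sup>2"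
          using \<open>\<delta> > 0\<close> by (simp add: Y.norm_scale norm_mult norm_cj power2_eq_square mult.assoc)
      qed
      finally show "norm ((R' - R) u) \<le> 2 * \<delta> * (\<Sum>i<n. (norm (e i))\<^sup>2)"
        by (simp add: sum_distrib_left)
    qed
  qed
qed

lemma finite_rank_ops_subset_closure:
  assumes X: "\<exists>x::'x. x \<noteq> 0" and Y: "\<exists>y::'y. y \<noteq> 0"
  shows "finite_rank_ops sX sY \<subseteq> closure {R \<in> finite_rank_ops sX sY.
    range_strongly_exposing dual_scale (dual sY) (adjoint_op R :: ('y \<Rightarrow>\<^sub>L 'k) \<Rightarrow> ('x \<Rightarrow>\<^sub>L 'k))}"
proof
  fix R assume "R \<in> finite_rank_ops sX sY"
  then obtain n :: nat and c :: "nat \<Rightarrow> 'x \<Rightarrow>\<^sub>L 'k" and e :: "nat \<Rightarrow> 'y"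
    where c: "\<And>i. i < n \<Longrightarrow> c i \<in> dual sX" and Rc: "\<And>u. blinfun_apply R u = (\<Sum>i<n. sY (c i u) (e i))"
    using finite_rank_op_coordinates by metis
  define S where "S = (\<Sum>i<n. (norm (e i))\<^sup>2)"
  have "S \<ge> 0" unfolding S_def by (intro sum_nonneg) auto
  show "R \<in> closure {R \<in> finite_rank_ops sX sY.
    range_strongly_exposing dual_scale (dual sY) (adjoint_op R :: ('y \<Rightarrow>\<^sub>L 'k) \<Rightarrow> ('x \<Rightarrow>\<^sub>L 'k))}"
    unfolding closure_approachable
  proof (intro allI impI)
    fix \<epsilon> :: real assume "\<epsilon> > 0"
    define \<delta> where "\<delta> = \<epsilon> / (2 * (S + 1))"
    have "\<delta> > 0" using \<open>\<epsilon> > 0\<close> \<open>S \<ge> 0\<close> by (simp add: \<delta>_def)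
    obtain R' where R': "R' \<in> finite_rank_ops sX sY"
      "range_strongly_exposing dual_scale (dual sY) (adjoint_op R' :: ('y \<Rightarrow>\<^sub>L 'k) \<Rightarrow> ('x \<Rightarrow>\<^sub>L 'k))"
      "norm (R' - R) \<le> 2 * \<delta> * S"
      using ex_range_strongly_exposing_near[OF c Rc X Y \<open>\<delta> > 0\<close>] unfolding S_def by blast
    have "2 * \<delta> * S < \<epsilon>" using \<open>\<epsilon> > 0\<close> \<open>S \<ge> 0\<close> by (simp add: \<delta>_def field_simps)
    with R' show "\<exists>R'\<in>{R \<in> finite_rank_ops sX sY.
        range_strongly_exposing dual_scale (dual sY) (adjoint_op R :: ('y \<Rightarrow>\<^sub>L 'k) \<Rightarrow> ('x \<Rightarrow>\<^sub>L 'k))}. dist R' R < \<epsilon>"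
      by (intro bexI[of _ R']) (auto simp: dist_norm)
  qed
qed

end

section \<open>Approximating elements of the bidual on compact sets\<close>

lemma (in normed_space_over) norm_dual_le_of_re:
  assumes z: "z \<in> dual scale" and "M \<ge> 0" and le: "\<And>x. norm x \<le> M \<Longrightarrow> re (blinfun_apply z x) \<le> b"
  shows "M * norm z \<le> b"
proof (cases "M = 0")
  case True
  have "re (z 0) \<le> b" using \<open>M \<ge> 0\<close> by (intro le) simp
  then show ?thesis using True re_of_real[of 0, where 'a='k] by simp
next
  case False
  have "norm z \<le> b / M"
  proof (rule norm_blinfun_le_on_ball)
    fix u :: 'a assume u: "norm u \<le> 1"
    obtain \<theta> where \<theta>: "norm \<theta> = 1" "\<theta> * z u = of_real (norm (z u))" using ex_rotation by blast
    have "M * norm (z u) = re (z (scale (of_real M * \<theta>) u))"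
      by (simp add: dual_apply_scale[OF z] mult.assoc \<theta> re_of_real flip: of_real_mult)
    also have "\<dots> \<le> b"
      using \<open>M \<ge> 0\<close> u by (intro le) (simp add: norm_scale norm_mult \<theta> mult_left_le)
    finally show "norm (z u) \<le> b / M" using False \<open>M \<ge> 0\<close> by (simp add: pos_le_divide_eq mult.commute)
  qed
  then show ?thesis using False \<open>M \<ge> 0\<close> by (simp add: pos_le_divide_eq mult.commute)
qed

text \<open>Helly's theorem. The proof is the projection argument of Hilbert space geometry: let \<open>x0\<close> nearly
minimise the square distance \<open>\<rho>\<close> between the values of \<open>\<phi>\<close> and of the evaluation at \<open>x\<close>, over the ball of
radius \<open>M\<close>. Moving from \<open>x0\<close> a small step towards another point of the ball hardly decreases \<open>\<rho>\<close>, so the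
functional \<open>w\<close> with the conjugates of the residuals \<open>r\<close> as coefficients nearly attains the supremum of its
real part over the ball at \<open>x0\<close>. That supremum dominates \<open>re (\<phi> w)\<close>, and \<open>re (\<phi> w) - re (w x0)\<close> is exactly \<open>\<rho> x0\<close>, which
is therefore small.\<close>
lemma (in normed_space_over) ex_evaluation_near_finite:
  fixes \<phi> :: "('a \<Rightarrow>\<^sub>L 'k) \<Rightarrow> 'k" and n :: nat
  assumes sum: "\<And>c z (n::nat). (\<And>i. i < n \<Longrightarrow> z i \<in> dual scale) \<Longrightarrow>
      \<phi> (\<Sum>i<n. dual_scale (c i) (z i)) = (\<Sum>i<n. c i * \<phi> (z i))"
    and bound: "\<And>z. z \<in> dual scale \<Longrightarrow> norm (\<phi> z) \<le> M * norm z" and "M \<ge> 0"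
    and z: "\<And>j. j < n \<Longrightarrow> z j \<in> dual scale" and "\<epsilon> > 0"
  obtains x where "norm x \<le> M" "\<And>j. j < n \<Longrightarrow> norm (\<phi> (z j) - blinfun_apply (z j) x) < \<epsilon>"
proof -
  define \<rho> where "\<rho> x = (\<Sum>j<n. (norm (\<phi> (z j) - z j x))\<^sup>2)" for x
  have \<rho>_nonneg: "\<rho> x \<ge> 0" for x unfolding \<rho>_def by (intro sum_nonneg) auto
  define d where "d = (INF x\<in>cball 0 M. \<rho> x)"
  have bdd: "bdd_below (\<rho> ` cball 0 M)" using \<rho>_nonneg by (intro bdd_belowI2) auto
  have ne: "cball (0::'a) M \<noteq> {}" using \<open>M \<ge> 0\<close> by auto
  define D where "D = (\<Sum>j<n. (2 * M * norm (z j))\<^sup>2)"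
  have "D \<ge> 0" unfolding D_def by (intro sum_nonneg) auto
  define K where "K = (D + 1) / 2"
  have "K > 0" using \<open>D \<ge> 0\<close> by (simp add: K_def)
  \<comment> \<open>The step \<open>t\<close> costs \<open>t\<^sup>2\<close> both from the near-minimality of \<open>x0\<close> and from the quadratic term, so after
    division by \<open>2 * t\<close> the error is at most \<open>t * K\<close>.\<close>
  define t where "t = min 1 (\<epsilon>\<^sup>2 / (K + 1))"
  have t: "0 < t" "t \<le> 1" "t * K < \<epsilon>\<^sup>2"
  proof -
    show "0 < t" "t \<le> 1" using \<open>K > 0\<close> \<open>\<epsilon> > 0\<close> by (auto simp: t_def)
    have "t * K \<le> \<epsilon>\<^sup>2 / (K + 1) * K" using \<open>K > 0\<close> by (intro mult_right_mono) (auto simp: t_def)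
    also have "\<dots> < \<epsilon>\<^sup>2" using \<open>K > 0\<close> \<open>\<epsilon> > 0\<close> by (simp add: field_simps)
    finally show "t * K < \<epsilon>\<^sup>2" .
  qed
  have "d < d + t\<^sup>2" using t by simp
  then obtain x0 where x0: "norm x0 \<le> M" "\<rho> x0 < d + t\<^sup>2"
    using cINF_less_iff[OF ne bdd, of "d + t\<^sup>2"] by (auto simp: d_def)
  define r where "r j = \<phi> (z j) - z j x0" for j
  define w where "w = (\<Sum>j<n. dual_scale (cj (r j)) (z j))"
  have w: "w \<in> dual scale" unfolding w_def using z by (intro dual_sum dual_scale_in_dual) auto
  have "M * norm w \<le> re (w x0) + t * K"
  proof (rule norm_dual_le_of_re[OF w \<open>M \<ge> 0\<close>])
    fix x :: 'a assume x: "norm x \<le> M"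
    define a where "a j = z j x - z j x0" for j
    have "norm ((1 - t) *\<^sub>R x0 + t *\<^sub>R x) \<le> (1 - t) * M + t * M"
      using t x x0(1) by (intro norm_triangle_le add_mono) (auto intro!: mult_left_mono)
    then have "(1 - t) *\<^sub>R x0 + t *\<^sub>R x \<in> cball 0 M" by (simp add: algebra_simps)
    then have "d \<le> \<rho> ((1 - t) *\<^sub>R x0 + t *\<^sub>R x)" unfolding d_def by (rule cINF_lower[OF bdd])
    also have "\<dots> = (\<Sum>j<n. (norm (r j - t *\<^sub>R a j))\<^sup>2)"
    proof -
      have "\<phi> (z j) - z j ((1 - t) *\<^sub>R x0 + t *\<^sub>R x) = r j - t *\<^sub>R a j" for j
        by (simp add: r_def a_def blinfun.add_right blinfun.scaleR_right) (simp add: algebra_simps)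
      then show ?thesis by (simp only: \<rho>_def)
    qed
    also have "\<dots> = (\<Sum>j<n. (norm (r j))\<^sup>2 - 2 * t * re (cj (r j) * a j) + t\<^sup>2 * (norm (a j))\<^sup>2)"
    proof (rule sum.cong[OF refl])
      fix j
      show "(norm (r j - t *\<^sub>R a j))\<^sup>2 = (norm (r j))\<^sup>2 - 2 * t * re (cj (r j) * a j) + t\<^sup>2 * (norm (a j))\<^sup>2"
        using re_simps(4)[of "- t" "cj (r j) * a j"]
        by (simp add: norm_square_expand[of "r j - t *\<^sub>R a j" "r j"] power_mult_distrib)
    qed
    also have "\<dots> = \<rho> x0 - 2 * t * re (\<Sum>j<n. cj (r j) * a j) + t\<^sup>2 * (\<Sum>j<n. (norm (a j))\<^sup>2)"
      by (simp add: \<rho>_def r_def sum.distrib sum_subtractf sum_distrib_left re_simps)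
    also have "(\<Sum>j<n. cj (r j) * a j) = w x - w x0"
      by (simp add: w_def a_def blinfun.sum_left dual_scale_apply algebra_simps sum_subtractf)
    also have "re (w x - w x0) = re (w x) - re (w x0)" by (simp add: re_simps)
    finally have "d \<le> \<rho> x0 - 2 * t * (re (w x) - re (w x0)) + t\<^sup>2 * (\<Sum>j<n. (norm (a j))\<^sup>2)" .
    moreover have "(\<Sum>j<n. (norm (a j))\<^sup>2) \<le> D"
      unfolding D_def
    proof (intro sum_mono power_mono)
      fix j
      have "norm (a j) \<le> norm (z j) * norm (x - x0)"
        using norm_blinfun[of "z j" "x - x0"] by (simp add: a_def blinfun.diff_right)
      also have "\<dots> \<le> norm (z j) * (2 * M)"
        using norm_triangle_ineq4[of x x0] x x0(1) by (intro mult_left_mono) auto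
      finally show "norm (a j) \<le> 2 * M * norm (z j)" by (simp add: mult_ac)
    qed auto
    then have "t\<^sup>2 * (\<Sum>j<n. (norm (a j))\<^sup>2) \<le> t\<^sup>2 * D" by (intro mult_left_mono) auto
    ultimately have "2 * t * (re (w x) - re (w x0)) \<le> t\<^sup>2 * (D + 1)"
      using x0(2) by (simp add: algebra_simps)
    then have "t * (2 * (re (w x) - re (w x0))) \<le> t * (t * (D + 1))"
      by (simp add: power2_eq_square mult_ac)
    then have "2 * (re (w x) - re (w x0)) \<le> t * (D + 1)" using t(1) by simp
    then show "re (w x) \<le> re (w x0) + t * K" by (simp add: K_def)
  qed
  moreover have "\<rho> x0 \<le> M * norm w - re (w x0)"
  proof -
    have "of_real (\<rho> x0) = (\<Sum>j<n. cj (r j) * r j)" by (simp add: \<rho>_def r_def cj_mult_self)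
    also have "\<dots> = (\<Sum>j<n. cj (r j) * \<phi> (z j)) - (\<Sum>j<n. cj (r j) * z j x0)"
      by (simp add: r_def algebra_simps sum_subtractf)
    also have "(\<Sum>j<n. cj (r j) * \<phi> (z j)) = \<phi> w" unfolding w_def using z by (simp add: sum)
    also have "(\<Sum>j<n. cj (r j) * z j x0) = w x0" by (simp add: w_def blinfun.sum_left dual_scale_apply)
    finally have "\<rho> x0 = re (\<phi> w) - re (w x0)"
      using re_of_real[of "\<rho> x0", where 'a='k] by (simp add: re_simps)
    moreover have "re (\<phi> w) \<le> M * norm w" using re_le_norm[of "\<phi> w"] bound[OF w] by simp
    ultimately show ?thesis by simp
  qed
  ultimately have "\<rho> x0 < \<epsilon>\<^sup>2" using t(3) by simp
  have "norm (\<phi> (z j) - z j x0) < \<epsilon>" if "j < n" for j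
  proof (rule power_less_imp_less_base)
    have "(norm (\<phi> (z j) - z j x0))\<^sup>2 \<le> \<rho> x0"
      unfolding \<rho>_def using that by (intro member_le_sum) auto
    then show "(norm (\<phi> (z j) - z j x0))\<^sup>2 < \<epsilon>\<^sup>2" using \<open>\<rho> x0 < \<epsilon>\<^sup>2\<close> by simp
  qed (use \<open>\<epsilon> > 0\<close> in simp)
  with x0(1) show thesis using that by blast
qed

lemma compact_finite_net:
  fixes C :: "'a::metric_space set"
  assumes "compact C" "\<epsilon> > 0"
  obtains n :: nat and z where "\<And>i. i < n \<Longrightarrow> z i \<in> C" "\<And>x. x \<in> C \<Longrightarrow> \<exists>i<n. dist x (z i) < \<epsilon>"
proof -
  obtain N where N: "finite N" "N \<subseteq> C" "C \<subseteq> (\<Union>x\<in>N. ball x \<epsilon>)"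
    using compactE_image[OF assms(1), of C "\<lambda>x. ball x \<epsilon>"] assms(2) by force
  obtain n :: nat and z where z: "N = z ` {i. i < n}" using finite_imp_nat_seg_image_inj_on[OF N(1)] by blast
  show thesis
  proof
    show "z i \<in> C" if "i < n" for i using that N(2) z by auto
    show "\<exists>i<n. dist x (z i) < \<epsilon>" if "x \<in> C" for x
    proof -
      obtain y where "y \<in> N" "dist x y < \<epsilon>"
        using \<open>x \<in> C\<close> N(3) by (auto simp: dist_commute)
      then show ?thesis using z by blast
    qed
  qed
qed

text \<open>The norms of the approximating points are at most \<open>M\<close>, so an approximation on a fine finite net
is one on the whole compact set.\<close>
lemma (in normed_space_over) ex_evaluation_near_compact:
  fixes \<phi> :: "('a \<Rightarrow>\<^sub>L 'k) \<Rightarrow> 'k"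
  assumes add: "\<And>z w. z \<in> dual scale \<Longrightarrow> w \<in> dual scale \<Longrightarrow> \<phi> (z + w) = \<phi> z + \<phi> w"
    and scale: "\<And>c z. z \<in> dual scale \<Longrightarrow> \<phi> (dual_scale c z) = c * \<phi> z"
    and bound: "\<And>z. z \<in> dual scale \<Longrightarrow> norm (\<phi> z) \<le> M * norm z" and "M \<ge> 0"
    and L: "compact L" "L \<subseteq> dual scale" and "\<epsilon> > 0"
  obtains x where "\<And>z. z \<in> L \<Longrightarrow> norm (\<phi> z - blinfun_apply z x) < \<epsilon>"
proof -
  define \<eta> where "\<eta> = \<epsilon> / (4 * (M + 1))"
  have "\<eta> > 0" "M * \<eta> \<le> \<epsilon> / 4"
    using \<open>\<epsilon> > 0\<close> \<open>M \<ge> 0\<close> by (auto simp: \<eta>_def field_simps)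
  obtain n :: nat and z where z: "\<And>i. i < n \<Longrightarrow> z i \<in> L"
    and net: "\<And>x. x \<in> L \<Longrightarrow> \<exists>i<n. dist x (z i) < \<eta>"
    using compact_finite_net[OF L(1) \<open>\<eta> > 0\<close>] by metis
  have zero: "\<phi> 0 = 0" using bound[of 0] by (simp add: dual_def bounded_ops_def)
  have sum: "\<phi> (\<Sum>i<n. dual_scale (c i) (z i)) = (\<Sum>i<n. c i * \<phi> (z i))"
    if "\<And>i. i < n \<Longrightarrow> z i \<in> dual scale" for c z and n :: nat
    using that
  proof (induction n)
    case (Suc n)
    have "(\<Sum>i<n. dual_scale (c i) (z i)) \<in> dual scale" "dual_scale (c n) (z n) \<in> dual scale"
      using Suc.prems by (auto intro!: dual_sum dual_scale_in_dual)
    then have "\<phi> (\<Sum>i<Suc n. dual_scale (c i) (z i))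
        = \<phi> (\<Sum>i<n. dual_scale (c i) (z i)) + \<phi> (dual_scale (c n) (z n))"
      by (simp add: add)
    then show ?case using Suc by (simp add: scale)
  qed (simp add: zero)
  have zd: "z i \<in> dual scale" if "i < n" for i using z[OF that] L(2) by blast
  obtain x where x: "norm x \<le> M" "\<And>j. j < n \<Longrightarrow> norm (\<phi> (z j) - z j x) < \<epsilon> / 2"
    by (rule ex_evaluation_near_finite[of \<phi> M n z "\<epsilon> / 2"])
      (use sum bound zd \<open>M \<ge> 0\<close> \<open>\<epsilon> > 0\<close> in auto)
  show thesis
  proof
    fix y assume "y \<in> L"
    then have y: "y \<in> dual scale" using L(2) by blast
    obtain j where j: "j < n" "norm (y - z j) < \<eta>"
      using net[OF \<open>y \<in> L\<close>] by (auto simp: dist_norm)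
    have yz: "y - z j \<in> dual scale" using y zd[OF j(1)] by (rule dual_diff)
    have "\<phi> y = \<phi> (z j) + \<phi> (y - z j)" using add[OF zd[OF j(1)] yz] by simp
    then have "\<phi> y - y x = \<phi> (y - z j) + (\<phi> (z j) - z j x) - (y - z j) x"
      by (simp add: blinfun.diff_left)
    then have eq: "norm (\<phi> y - y x) = norm (\<phi> (y - z j) + (\<phi> (z j) - z j x) - (y - z j) x)"
      by (simp only:)
    have "norm (\<phi> y - y x) \<le> norm (\<phi> (y - z j)) + norm (\<phi> (z j) - z j x) + norm ((y - z j) x)"
      unfolding eq using norm_triangle_ineq4[of "\<phi> (y - z j) + (\<phi> (z j) - z j x)" "(y - z j) x"]
        norm_triangle_ineq[of "\<phi> (y - z j)" "\<phi> (z j) - z j x"] by linarith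
    moreover have "norm (\<phi> (y - z j)) \<le> M * \<eta>"
      using bound[OF yz] mult_left_mono[of "norm (y - z j)" \<eta> M] j(2) \<open>M \<ge> 0\<close> by simp
    moreover have "norm ((y - z j) x) \<le> M * \<eta>"
      using norm_blinfun[of "y - z j" x] mult_mono[of "norm (y - z j)" \<eta> "norm x" M] j(2) x(1)
        \<open>\<eta> > 0\<close> by (simp add: mult.commute)
    ultimately show "norm (\<phi> y - y x) < \<epsilon>"
      using x(2)[OF j(1)] \<open>M * \<eta> \<le> \<epsilon> / 4\<close> by linarith
  qed
qed

section \<open>Compact operators and the approximation property\<close>

lemma finite_rank_onD:
  assumes "finite_rank_on s V T"
  shows "\<forall>x\<in>V. \<forall>y\<in>V. T (x + y) = T x + T y" "\<forall>c. \<forall>x\<in>V. T (s c x) = s c (T x)"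
    "T ` V \<subseteq> V" "\<exists>M\<ge>0. \<forall>x\<in>V. norm (T x) \<le> M * norm x"
    "\<exists>B. finite B \<and> T ` V \<subseteq> module.span s B"
proof -
  note T = assms[unfolded finite_rank_on_def]
  show "\<forall>x\<in>V. \<forall>y\<in>V. T (x + y) = T x + T y" by (rule conjunct1[OF T])
  show "\<forall>c. \<forall>x\<in>V. T (s c x) = s c (T x)" using T by (elim conjE)
  show "T ` V \<subseteq> V" using T by (elim conjE)
  show "\<exists>B. finite B \<and> T ` V \<subseteq> module.span s B" using T by (elim conjE)
  have "\<exists>M. \<forall>x\<in>V. norm (T x) \<le> M * norm x" using T by (elim conjE)
  then obtain M where M: "\<And>x. x \<in> V \<Longrightarrow> norm (T x) \<le> M * norm x" by blast
  have "norm (T x) \<le> \<bar>M\<bar> * norm x" if "x \<in> V" for x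
    by (rule order_trans[OF M[OF that]]) (intro mult_right_mono, auto)
  then show "\<exists>M\<ge>0. \<forall>x\<in>V. norm (T x) \<le> M * norm x" by (intro exI[of _ "\<bar>M\<bar>"]) simp
qed

context normed_space_pair
begin

text \<open>A strong form of Schauder's theorem: on the dual ball, pointwise convergence is uniform on compact
sets, so the adjoint of a compact operator is continuous from the pointwise topology to the norm, and
the image of the ball is compact rather than only relatively compact.\<close>
lemma compact_adjoint_image:
  assumes T: "T \<in> compact_ops sX sY"
  shows "compact (adjoint_op T ` (dual sY \<inter> cball 0 1) :: ('x \<Rightarrow>\<^sub>L 'k) set)"
proof -
  let ?B = "dual sY \<inter> cball 0 1 :: ('y \<Rightarrow>\<^sub>L 'k) set"
  let ?C = "closure (blinfun_apply T ` cball 0 1)"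
  let ?F = "\<lambda>g. adjoint_op T (Blinfun g) :: 'x \<Rightarrow>\<^sub>L 'k"
  have C: "compact ?C" using T by (simp add: compact_ops_def)
  have F: "?F (blinfun_apply f) = adjoint_op T f" for f
    by (simp add: blinfun_apply_inverse)
  have "continuous_on (blinfun_apply ` ?B) ?F"
    unfolding continuous_on_topological
  proof (intro ballI allI impI)
    fix g and U :: "('x \<Rightarrow>\<^sub>L 'k) set"
    assume "g \<in> blinfun_apply ` ?B" and U: "open U" "?F g \<in> U"
    then obtain f where f: "f \<in> ?B" "g = blinfun_apply f" by blast
    obtain \<epsilon> where \<epsilon>: "\<epsilon> > 0" "ball (adjoint_op T f) \<epsilon> \<subseteq> U"
      using U open_contains_ball unfolding f(2) F by blast
    have "\<epsilon> / 4 > 0" using \<epsilon> by simp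
    then obtain n :: nat and c where c: "\<And>i. i < n \<Longrightarrow> c i \<in> ?C"
      and net: "\<And>y. y \<in> ?C \<Longrightarrow> \<exists>i<n. dist y (c i) < \<epsilon> / 4"
      using compact_finite_net[OF C] by metis
    define A where "A = (\<Inter>i\<in>{..<n}. (\<lambda>h :: 'y \<Rightarrow> 'k. h (c i)) -` ball (g (c i)) (\<epsilon> / 4))"
    have "open A"
      unfolding A_def by (intro open_INT ballI open_vimage continuous_on_product_coordinates) auto
    moreover have "g \<in> A" using \<epsilon> by (simp add: A_def)
    moreover have "?F h \<in> U" if "h \<in> blinfun_apply ` ?B" "h \<in> A" for h
    proof -
      obtain k where k: "k \<in> ?B" "h = blinfun_apply k" using \<open>h \<in> blinfun_apply ` ?B\<close> by blast
      have "norm (adjoint_op T k - adjoint_op T f) \<le> 3 * \<epsilon> / 4"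
      proof (rule norm_blinfun_le_on_ball)
        fix u :: 'x assume "norm u \<le> 1"
        then have "T u \<in> ?C" by (intro subsetD[OF closure_subset] imageI) simp
        then obtain i where i: "i < n" "norm (T u - c i) < \<epsilon> / 4"
          using net by (auto simp: dist_norm)
        have "norm (k (c i) - f (c i)) < \<epsilon> / 4"
          using \<open>h \<in> A\<close> i(1) by (auto simp: A_def k(2) f(2) dist_norm norm_minus_commute)
        moreover have "norm (k (T u - c i)) \<le> norm (T u - c i)" "norm (f (T u - c i)) \<le> norm (T u - c i)"
          using k(1) f(1) by (auto intro: norm_apply_le_of_ball)
        moreover have "(adjoint_op T k - adjoint_op T f) u = k (T u - c i) + (k (c i) - f (c i)) - f (T u - c i)"
          by (simp add: adjoint_op_apply blinfun.diff_left blinfun.diff_right)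
        ultimately show "norm ((adjoint_op T k - adjoint_op T f) u) \<le> 3 * \<epsilon> / 4"
          using i(2) norm_triangle_ineq4[of "k (T u - c i) + (k (c i) - f (c i))" "f (T u - c i)"]
            norm_triangle_ineq[of "k (T u - c i)" "k (c i) - f (c i)"] by simp
      qed
      then have "adjoint_op T k \<in> ball (adjoint_op T f) \<epsilon>"
        using \<epsilon>(1) by (simp add: dist_norm norm_minus_commute)
      then show ?thesis using \<epsilon>(2) by (auto simp: k(2) F)
    qed
    ultimately show "\<exists>A. open A \<and> g \<in> A \<and> (\<forall>y\<in>blinfun_apply ` ?B. y \<in> A \<longrightarrow> ?F y \<in> U)" by blast
  qed
  then have "compact (?F ` blinfun_apply ` ?B)"
    using Y.compact_dual_ball by (rule compact_continuous_image)
  then show ?thesis by (simp add: image_image F)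
qed

lemma norm_le_of_adjoint_op:
  assumes "\<And>f :: 'y \<Rightarrow>\<^sub>L 'k. f \<in> dual sY \<Longrightarrow> norm f \<le> 1 \<Longrightarrow> norm (adjoint_op A f :: 'x \<Rightarrow>\<^sub>L 'k) \<le> b"
  shows "norm A \<le> b"
proof (rule norm_blinfun_le_on_ball)
  fix u :: 'x assume u: "norm u \<le> 1"
  obtain f :: "'y \<Rightarrow>\<^sub>L 'k" where f: "f \<in> dual sY" "norm f \<le> 1" "f (A u) = of_real (norm (A u))"
    by (rule Y.ex_norming_functional)
  have "norm (A u) = norm (adjoint_op A f u)" by (simp add: adjoint_op_apply f(3))
  also have "\<dots> \<le> norm (adjoint_op A f) * norm u" by (rule norm_blinfun)
  also have "\<dots> \<le> norm (adjoint_op A f) * 1" using u by (intro mult_left_mono) auto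
  also have "\<dots> \<le> b" using assms[OF f(1,2)] by simp
  finally show "norm (A u) \<le> b" .
qed

lemma finite_rank_near_compact_if_ap_codomain:
  assumes T: "T \<in> compact_ops sX sY" and ap: "approximation_property sY UNIV" and "\<epsilon> > 0"
  shows "\<exists>R\<in>finite_rank_ops sX sY. norm (R - T) \<le> \<epsilon>"
proof -
  let ?C = "closure (blinfun_apply T ` cball 0 1)"
  have "compact ?C" and T': "T \<in> bounded_ops sX sY" using T by (auto simp: compact_ops_def)
  then have "\<exists>S. finite_rank_on sY UNIV S \<and> (\<forall>y\<in>?C. norm (S y - y) < \<epsilon>)"
    using ap[unfolded approximation_property_def, rule_format, of ?C \<epsilon>] \<open>\<epsilon> > 0\<close> by simp
  then obtain S where S: "finite_rank_on sY UNIV S" and near: "\<And>y. y \<in> ?C \<Longrightarrow> norm (S y - y) < \<epsilon>"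
    by blast
  note SD = finite_rank_onD[OF S]
  obtain M where M: "M \<ge> 0" "\<And>x. norm (S x) \<le> M * norm x" using SD(4) by auto
  obtain B where B: "finite B" "range S \<subseteq> Y.span B" using SD(5) by (elim exE conjE)
  obtain S' where S': "S' \<in> bounded_ops sY sY" "blinfun_apply S' = S"
  proof (rule ex_bounded_op[OF Y.normed_space_over_axioms Y.normed_space_over_axioms, of S M])
    show "S (x + y) = S x + S y" for x y using SD(1) by blast
    show "S (sY c x) = sY c (S x)" for c x using SD(2) by blast
  qed (use M in auto)
  have "S' o\<^sub>L T \<in> bounded_ops sX sY" using S'(1) T' by (simp add: bounded_ops_def)
  moreover have "range (blinfun_apply (S' o\<^sub>L T)) \<subseteq> Y.span B"
    using B(2) by (simp add: S'(2) image_subset_iff)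
  ultimately have "S' o\<^sub>L T \<in> finite_rank_ops sX sY"
    using B(1) unfolding finite_rank_ops_def by blast
  moreover have "norm ((S' o\<^sub>L T) - T) \<le> \<epsilon>"
  proof (rule norm_blinfun_le_on_ball)
    fix u :: 'x assume "norm u \<le> 1"
    then have "T u \<in> ?C" by (intro subsetD[OF closure_subset] imageI) simp
    then show "norm (((S' o\<^sub>L T) - T) u) \<le> \<epsilon>"
      using near[of "T u"] by (simp add: blinfun.diff_left S'(2))
  qed
  ultimately show ?thesis by blast
qed

text \<open>The coordinate functionals of the approximating operator \<open>S\<close> on the dual of \<open>X\<close> are replaced by
evaluations at points of \<open>X\<close>, uniformly on the compact image of the dual ball; this makes
\<open>S\<close> composed with the adjoint of \<open>T\<close> nearly the adjoint of an operator from \<open>X\<close> to \<open>Y\<close>.\<close>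
lemma finite_rank_near_compact_if_ap_dual:
  assumes T: "T \<in> compact_ops sX sY"
    and ap: "approximation_property dual_scale (dual sX :: ('x \<Rightarrow>\<^sub>L 'k) set)" and "\<epsilon> > 0"
  shows "\<exists>R\<in>finite_rank_ops sX sY. norm (R - T) \<le> \<epsilon>"
proof -
  interpret D: normed_space_over "dual_scale :: 'k \<Rightarrow> ('x \<Rightarrow>\<^sub>L 'k) \<Rightarrow> ('x \<Rightarrow>\<^sub>L 'k)"
    by (rule normed_space_over_dual)
  let ?V = "dual sX :: ('x \<Rightarrow>\<^sub>L 'k) set"
  define L where "L = (adjoint_op T ` (dual sY \<inter> cball 0 1) :: ('x \<Rightarrow>\<^sub>L 'k) set)"
  have T': "T \<in> bounded_ops sX sY" using T by (simp add: compact_ops_def)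
  have L: "compact L" "L \<subseteq> ?V"
    using compact_adjoint_image[OF T] adjoint_op_in_dual[OF T'] by (auto simp: L_def)
  obtain S where S: "finite_rank_on dual_scale ?V S" and near: "\<And>z. z \<in> L \<Longrightarrow> norm (S z - z) < \<epsilon> / 2"
    using ap L \<open>\<epsilon> > 0\<close> unfolding approximation_property_def by (metis half_gt_zero)
  note SD = finite_rank_onD[OF S]
  have add: "S (z + w) = S z + S w" if "z \<in> ?V" "w \<in> ?V" for z w using SD(1) that by blast
  have scale: "S (dual_scale c z) = dual_scale c (S z)" if "z \<in> ?V" for c z using SD(2) that by blast
  note SV = SD(3)
  obtain M where M: "\<And>z. z \<in> ?V \<Longrightarrow> norm (S z) \<le> M * norm z" "M \<ge> 0" using SD(4) by auto
  obtain B where B: "finite B" "S ` ?V \<subseteq> D.span B" using SD(5) by (elim exE conjE)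
  \<comment> \<open>The given finite set \<open>B\<close> may leave the dual; a basis chosen inside the range of \<open>S\<close> does not.\<close>
  obtain B' where B': "B' \<subseteq> S ` ?V" "D.independent B'" "S ` ?V \<subseteq> D.span B'"
    by (rule D.maximal_independent_subset)
  have "finite B'" using D.independent_span_bound[OF B(1) B'(2) subset_trans[OF B'(1) B(2)]] by (rule conjunct1)
  then obtain n :: nat and b and f :: "nat \<Rightarrow> ('x \<Rightarrow>\<^sub>L 'k) \<Rightarrow>\<^sub>L 'k"
    where b: "\<And>i. i < n \<Longrightarrow> b i \<in> D.span B'" and f: "\<And>i. i < n \<Longrightarrow> f i \<in> dual dual_scale"
    and id: "\<And>z. z \<in> D.span B' \<Longrightarrow> (\<Sum>i<n. dual_scale (f i z) (b i)) = z"
    using D.finite_span_coordinates[OF \<open>finite B'\<close>] by blast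
  have "D.subspace ?V"
    unfolding D.subspace_def by (auto simp: dual_add dual_scale_in_dual) (simp add: dual_def bounded_ops_def)
  then have "D.span B' \<subseteq> ?V" using D.span_minimal[OF subset_trans[OF B'(1) SV]] by blast
  then have bV: "b i \<in> ?V" if "i < n" for i using b[OF that] by blast
  define \<eta> where "\<eta> = \<epsilon> / (2 * ((\<Sum>i<n. norm (b i)) + 1))"
  have sum_b: "(\<Sum>i<n. norm (b i)) \<ge> 0" by (intro sum_nonneg) auto
  then have "\<eta> > 0" and \<eta>: "(\<Sum>i<n. norm (b i)) * \<eta> \<le> \<epsilon> / 2"
    using \<open>\<epsilon> > 0\<close> by (auto simp: \<eta>_def field_simps)
  have "\<exists>x. \<forall>z\<in>L. norm (f i (S z) - z x) < \<eta>" if "i < n" for i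
  proof -
    have bound: "norm (f i (S z)) \<le> norm (f i) * M * norm z" if "z \<in> ?V" for z
      using norm_blinfun[of "f i" "S z"] mult_left_mono[OF M(1)[OF that], of "norm (f i)"]
      by (simp add: mult.assoc)
    obtain x where "\<And>z. z \<in> L \<Longrightarrow> norm (f i (S z) - blinfun_apply z x) < \<eta>"
    proof (rule X.ex_evaluation_near_compact[of "\<lambda>z. f i (S z)" "norm (f i) * M" L \<eta>])
      show "f i (S (z + w)) = f i (S z) + f i (S w)" if "z \<in> ?V" "w \<in> ?V" for z w
        using that by (simp add: add blinfun.add_right)
      show "f i (S (dual_scale c z)) = c * f i (S z)" if "z \<in> ?V" for c z
        using that f[OF \<open>i < n\<close>] by (simp add: scale dual_apply_scale)
    qed (use bound M(2) L \<open>\<eta> > 0\<close> in auto)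
    then show ?thesis by blast
  qed
  then obtain x where x: "\<And>i z. i < n \<Longrightarrow> z \<in> L \<Longrightarrow> norm (f i (S z) - blinfun_apply z (x i)) < \<eta>" by metis
  obtain R where R: "R \<in> finite_rank_ops sX sY" and Rb: "\<And>u. blinfun_apply R u = (\<Sum>i<n. sY (b i u) (T (x i)))"
    using ex_finite_rank_op[of n b "\<lambda>i. T (x i)"] bV by blast
  have "norm (R - T) \<le> \<epsilon>"
  proof (rule norm_le_of_adjoint_op)
    fix y :: "'y \<Rightarrow>\<^sub>L 'k" assume y: "y \<in> dual sY" "norm y \<le> 1"
    define z where "z = adjoint_op T y"
    have z: "z \<in> L" "z \<in> ?V" using y L(2) by (auto simp: z_def L_def)
    have "adjoint_op R y = (\<Sum>i<n. dual_scale (z (x i)) (b i))"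
      unfolding adjoint_op_coordinates[OF Rb y(1)] by (simp add: z_def adjoint_op_apply)
    also have "\<dots> = (\<Sum>i<n. dual_scale (f i (S z)) (b i)) - (\<Sum>i<n. dual_scale (f i (S z) - z (x i)) (b i))"
      by (simp add: D.scale_left_diff_distrib sum_subtractf)
    also have "(\<Sum>i<n. dual_scale (f i (S z)) (b i)) = S z" using B'(3) z(2) by (intro id) auto
    finally have "adjoint_op (R - T) y = (S z - z) - (\<Sum>i<n. dual_scale (f i (S z) - z (x i)) (b i))"
      by (simp add: adjoint_op_diff_left z_def)
    then have eq: "norm (adjoint_op (R - T) y)
        = norm ((S z - z) - (\<Sum>i<n. dual_scale (f i (S z) - z (x i)) (b i)))" by (simp only:)
    have "norm (\<Sum>i<n. dual_scale (f i (S z) - z (x i)) (b i)) \<le> (\<Sum>i<n. norm (b i)) * \<eta>"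
      unfolding sum_distrib_right
    proof (rule sum_norm_le)
      fix i assume "i \<in> {..<n}"
      then have "norm (f i (S z) - z (x i)) \<le> \<eta>" using x[of i z] z(1) by simp
      then show "norm (dual_scale (f i (S z) - z (x i)) (b i)) \<le> norm (b i) * \<eta>"
        using mult_left_mono[of "norm (f i (S z) - z (x i))" \<eta> "norm (b i)"]
        by (simp add: norm_dual_scale mult.commute)
    qed
    then show "norm (adjoint_op (R - T) y) \<le> \<epsilon>"
      unfolding eq
      using near[OF z(1)] \<eta> norm_triangle_ineq4[of "S z - z" "\<Sum>i<n. dual_scale (f i (S z) - z (x i)) (b i)"]
      by linarith
  qed
  with R show ?thesis by blast
qed

lemma compact_ops_subset_closure_finite_rank:
  assumes "approximation_property dual_scale (dual sX :: ('x \<Rightarrow>\<^sub>L 'k) set) \<or> approximation_property sY UNIV"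
  shows "compact_ops sX sY \<subseteq> closure (finite_rank_ops sX sY)"
proof
  fix T assume T: "T \<in> compact_ops sX sY"
  show "T \<in> closure (finite_rank_ops sX sY)"
    unfolding closure_approachable_le dist_norm
    using assms finite_rank_near_compact_if_ap_dual[OF T] finite_rank_near_compact_if_ap_codomain[OF T]
    by blast
qed

end

theorem corollary5p5:
  fixes sX :: "'k::real_or_complex \<Rightarrow> 'x::banach \<Rightarrow> 'x"
    and sY :: "'k \<Rightarrow> 'y::banach \<Rightarrow> 'y"
  assumes "normed_space_over sX" and "normed_space_over sY"
    and "\<exists>x::'x. x \<noteq> 0" and "\<exists>y::'y. y \<noteq> 0"
  shows "finite_rank_ops sX sY
      \<subseteq> closure {R \<in> finite_rank_ops sX sY.
          range_strongly_exposing dual_scale (dual sY)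
            (adjoint_op R :: ('y \<Rightarrow>\<^sub>L 'k) \<Rightarrow> ('x \<Rightarrow>\<^sub>L 'k))} \<and>
    (approximation_property dual_scale (dual sX) \<or> approximation_property sY UNIV \<longrightarrow>
      compact_ops sX sY
      \<subseteq> closure {R \<in> finite_rank_ops sX sY.
          range_strongly_exposing dual_scale (dual sY)
            (adjoint_op R :: ('y \<Rightarrow>\<^sub>L 'k) \<Rightarrow> ('x \<Rightarrow>\<^sub>L 'k))})"
proof -
  interpret normed_space_pair sX sY
    using assms(1,2) by (simp add: normed_space_pair_def)
  let ?E = "{R \<in> finite_rank_ops sX sY.
      range_strongly_exposing dual_scale (dual sY) (adjoint_op R :: ('y \<Rightarrow>\<^sub>L 'k) \<Rightarrow> ('x \<Rightarrow>\<^sub>L 'k))}"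
  have fr: "finite_rank_ops sX sY \<subseteq> closure ?E"
    using assms(3,4) by (rule finite_rank_ops_subset_closure)
  then have "closure (finite_rank_ops sX sY) \<subseteq> closure ?E" by (simp add: closure_minimal)
  with fr show ?thesis using compact_ops_subset_closure_finite_rank by blast
qed

end
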